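(* Let $(X,x_0)$ be a pointed space which is semilocally strongly contractible at $x_0$, and $n\geq1$. Then $\mathcal{H}_n(X,x_0)\cong\prod^w_{i\in\mathbb{N}}\pi_n(X,x_0)$.
   Context: $X$ is semilocally strongly contractible at $x_0$ if there exists a neighborhood $U$ of $x_0$ such that the inclusion $U\hookrightarrow X$ is homotopic in $X$ to the constant map at $x_0$ relative to $\{x_0\}$. For $n\geq1$, the $n$-dimensional Hawaiian earring is $\mathbb{H}^n=\{(r_0,\dots,r_n)\in\mathbb{R}^{n+1} : (r_0-1/k)^2+\sum_{i=1}^n r_i^2=(1/k)^2 \text{ for some } k\in\mathbb{N}\}$ with base point $\theta=(0,\dots,0)$; $S^n_k$ denotes the $n$-sphere of radius $1/k$ in it. The $n$-Hawaiian group $\mathcal{H}_n(X,x_0)$ is the set of pointed homotopy classes (rel $\{\theta\}$) of continuous maps $f:(\mathbb{H}^n,\theta)\to(X,x_0)$, with group operation $[f][g]=[f\ast g]$, where $(f\ast g)|_{S^n_k}$ is the usual concatenation (as in $\pi_n$) of $f|_{S^n_k}$ and $g|_{S^n_k}$ for each $k$. $\prod^w_{i\in\mathbb{N}}G$ is the weak direct product of countably many copies of $G$ (sequences with all but finitely many entries trivial). *)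

theory Defs
  imports "HOL-Analysis.Analysis" "HOL-Algebra.Product_Groups"
begin

definition semilocally_strongly_contractible_at :: "'a topology \<Rightarrow> 'a \<Rightarrow> bool" where
  "semilocally_strongly_contractible_at X x0 \<longleftrightarrow>
     (\<exists>U. (\<exists>V. openin X V \<and> x0 \<in> V \<and> V \<subseteq> U) \<and> U \<subseteq> topspace X \<and>
          homotopic_with (\<lambda>h. h x0 = x0) (subtopology X U) X (\<lambda>x. x) (\<lambda>x. x0))"

text \<open>Points of R^n are functions nat => real vanishing from index n on.\<close>

definition cube :: "nat \<Rightarrow> (nat \<Rightarrow> real) topology" where
  "cube n = subtopology (Euclidean_space n) {t. \<forall>i<n. 0 \<le> t i \<and> t i \<le> 1}"

definition cube_boundary :: "nat \<Rightarrow> (nat \<Rightarrow> real) set" where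
  "cube_boundary n = {t \<in> topspace (cube n). \<exists>i<n. t i = 0 \<or> t i = 1}"

definition cube_maps :: "nat \<Rightarrow> 'a topology \<Rightarrow> 'a \<Rightarrow> ((nat \<Rightarrow> real) \<Rightarrow> 'a) set" where
  "cube_maps n X x0 = {f. continuous_map (cube n) X f \<and> f ` cube_boundary n \<subseteq> {x0}}"

definition cube_homotopic :: "nat \<Rightarrow> 'a topology \<Rightarrow> 'a \<Rightarrow> ((nat \<Rightarrow> real) \<Rightarrow> 'a) \<Rightarrow> ((nat \<Rightarrow> real) \<Rightarrow> 'a) \<Rightarrow> bool" where
  "cube_homotopic n X x0 f g \<longleftrightarrow>
     homotopic_with (\<lambda>h. \<forall>t\<in>cube_boundary n. h t = x0) (cube n) X f g"

definition cube_class :: "nat \<Rightarrow> 'a topology \<Rightarrow> 'a \<Rightarrow> ((nat \<Rightarrow> real) \<Rightarrow> 'a) \<Rightarrow> ((nat \<Rightarrow> real) \<Rightarrow> 'a) set" where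
  "cube_class n X x0 f = {g \<in> cube_maps n X x0. cube_homotopic n X x0 f g}"

definition cube_concat :: "((nat \<Rightarrow> real) \<Rightarrow> 'a) \<Rightarrow> ((nat \<Rightarrow> real) \<Rightarrow> 'a) \<Rightarrow> (nat \<Rightarrow> real) \<Rightarrow> 'a" where
  "cube_concat f g = (\<lambda>t. if t 0 \<le> 1/2 then f (t(0 := 2 * t 0)) else g (t(0 := 2 * t 0 - 1)))"

definition homotopy_group :: "nat \<Rightarrow> 'a topology \<Rightarrow> 'a \<Rightarrow> ((nat \<Rightarrow> real) \<Rightarrow> 'a) set monoid" where
  "homotopy_group n X x0 =
     \<lparr>carrier = cube_class n X x0 ` cube_maps n X x0,
      monoid.mult = (\<lambda>A B. cube_class n X x0 (cube_concat (SOME f. f \<in> A) (SOME g. g \<in> B))),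
      one = cube_class n X x0 (\<lambda>t. x0)\<rparr>"

definition hsphere :: "nat \<Rightarrow> nat \<Rightarrow> (nat \<Rightarrow> real) set" where
  "hsphere n k = {r. (\<forall>i>n. r i = 0) \<and>
      (r 0 - 1 / real k)\<^sup>2 + (\<Sum>i\<in>{1..n}. (r i)\<^sup>2) = (1 / real k)\<^sup>2}"

definition hawaiian_earring :: "nat \<Rightarrow> (nat \<Rightarrow> real) topology" where
  "hawaiian_earring n = subtopology (Euclidean_space (Suc n)) (\<Union>k\<in>{1..}. hsphere n k)"

definition hawaiian_base :: "nat \<Rightarrow> real" where
  "hawaiian_base = (\<lambda>i. 0)"

text \<open>Standard quotient map from the cube I^n onto the sphere S^n_k collapsing the boundary
  of the cube to the base point theta (injective on the interior of the cube).\<close>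

definition cube_to_sphere :: "nat \<Rightarrow> nat \<Rightarrow> (nat \<Rightarrow> real) \<Rightarrow> (nat \<Rightarrow> real)" where
  "cube_to_sphere n k t =
     (let c = (\<lambda>i. 2 * t i - 1);
          m = Max ((\<lambda>i. \<bar>c i\<bar>) ` {..<n});
          e = sqrt (\<Sum>i<n. (c i)\<^sup>2)
      in (\<lambda>j. if j = 0 then (1 + cos (pi * m)) / real k
             else if j \<le> n then (if e = 0 then 0 else sin (pi * m) * c (j - 1) / (real k * e))
             else 0))"

definition hawaiian_maps :: "nat \<Rightarrow> 'a topology \<Rightarrow> 'a \<Rightarrow> ((nat \<Rightarrow> real) \<Rightarrow> 'a) set" where
  "hawaiian_maps n X x0 = {f. continuous_map (hawaiian_earring n) X f \<and> f hawaiian_base = x0}"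

definition hawaiian_homotopic :: "nat \<Rightarrow> 'a topology \<Rightarrow> 'a \<Rightarrow> ((nat \<Rightarrow> real) \<Rightarrow> 'a) \<Rightarrow> ((nat \<Rightarrow> real) \<Rightarrow> 'a) \<Rightarrow> bool" where
  "hawaiian_homotopic n X x0 f g \<longleftrightarrow>
     homotopic_with (\<lambda>h. h hawaiian_base = x0) (hawaiian_earring n) X f g"

definition hawaiian_class :: "nat \<Rightarrow> 'a topology \<Rightarrow> 'a \<Rightarrow> ((nat \<Rightarrow> real) \<Rightarrow> 'a) \<Rightarrow> ((nat \<Rightarrow> real) \<Rightarrow> 'a) set" where
  "hawaiian_class n X x0 f = {g \<in> hawaiian_maps n X x0. hawaiian_homotopic n X x0 f g}"

definition hawaiian_concat :: "nat \<Rightarrow> ((nat \<Rightarrow> real) \<Rightarrow> 'a) \<Rightarrow> ((nat \<Rightarrow> real) \<Rightarrow> 'a) \<Rightarrow> (nat \<Rightarrow> real) \<Rightarrow> 'a" where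
  "hawaiian_concat n f g y =
     (let k = (SOME k. k \<ge> 1 \<and> y \<in> hsphere n k)
      in cube_concat (f \<circ> cube_to_sphere n k) (g \<circ> cube_to_sphere n k)
           (SOME t. t \<in> topspace (cube n) \<and> cube_to_sphere n k t = y))"

definition hawaiian_group :: "nat \<Rightarrow> 'a topology \<Rightarrow> 'a \<Rightarrow> ((nat \<Rightarrow> real) \<Rightarrow> 'a) set monoid" where
  "hawaiian_group n X x0 =
     \<lparr>carrier = hawaiian_class n X x0 ` hawaiian_maps n X x0,
      monoid.mult = (\<lambda>A B. hawaiian_class n X x0
                       (hawaiian_concat n (SOME f. f \<in> A) (SOME g. g \<in> B))),
      one = hawaiian_class n X x0 (\<lambda>y. x0)\<rparr>"

end

theory Submission
  imports Defs
begin

text \<open>A map on the earring is the same as a family of cube maps, one for each sphere, that shrink to the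
  base point. Continuity at the base point pushes all but finitely many spheres into the contractible
  neighbourhood of \<open>x0\<close>, so the contraction, applied to all these spheres at once, deforms any map
  to one that is constant off finitely many spheres. Hence restricting to the spheres gives
  finitely supported families of homotopy classes, and finitely many spherewise homotopies can always be
  glued, which yields injectivity and surjectivity.\<close>

section \<open>Homotopy groups via cubes\<close>

text \<open>The earring is not a CW wedge: a family of spherewise homotopies need not glue, since
  continuity at the common point forces the k-th one to stay near \<open>x0\<close> uniformly as k
  grows. A homotopy that moves infinitely many spheres is therefore taken from one fixed
  contraction. That contraction keeps \<open>x0\<close> fixed at all times, so by the tube lemma all
  tracks starting close enough to \<open>x0\<close> stay in a prescribed neighbourhood; this is
  where contractibility relative to the base point enters. One gluing argument serves maps and
  homotopies alike, because it carries a compact Hausdorff parameter space: a single point for maps,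
  the unit interval for homotopies. Both groups multiply classes through chosen representatives, so
  \<open>homotopy_group\<close> needs homotopy invariance of concatenation. Its group axioms are
  proved because \<open>sum_group\<close> is a generated subgroup, whose carrier is the set of
  finitely supported families only once the factors are known to be groups.\<close>

lemma mem_cube:
  "t \<in> topspace (cube n) \<longleftrightarrow> (\<forall>i\<ge>n. t i = 0) \<and> (\<forall>i<n. 0 \<le> t i \<and> t i \<le> 1)"
  by (auto simp: cube_def Euclidean_space_def)

lemma cube_boundary_subset: "t \<in> cube_boundary n \<Longrightarrow> t \<in> topspace (cube n)"
  by (simp add: cube_boundary_def)

lemma mem_cube_update:
  "t \<in> topspace (cube n) \<Longrightarrow> n \<ge> 1 \<Longrightarrow> 0 \<le> a \<Longrightarrow> a \<le> 1 \<Longrightarrow> t(0 := a) \<in> topspace (cube n)"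
  by (auto simp: mem_cube)

lemma cube_boundary_update:
  "t \<in> topspace (cube n) \<Longrightarrow> n \<ge> 1 \<Longrightarrow> a = 0 \<or> a = 1 \<Longrightarrow> t(0 := a) \<in> cube_boundary n"
  by (auto simp: mem_cube cube_boundary_def)

text \<open>If coordinate 0 is interior, the coordinate that puts \<open>t\<close> on a face is
  another one, and the update leaves it alone.\<close>

lemma cube_boundary_update_other:
  assumes t: "t \<in> cube_boundary n" and "t 0 \<noteq> 0" "t 0 \<noteq> 1" "n \<ge> 1" "0 \<le> a" "a \<le> 1"
  shows "t(0 := a) \<in> cube_boundary n"
proof -
  obtain i where "i < n" "t i = 0 \<or> t i = 1" using t by (auto simp: cube_boundary_def)
  then have "i < n \<and> ((t(0 := a)) i = 0 \<or> (t(0 := a)) i = 1)" using assms by (cases "i = 0") auto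
  then show ?thesis
    using mem_cube_update[OF cube_boundary_subset[OF t]] assms unfolding cube_boundary_def by blast
qed

lemma continuous_map_into_cube:
  "continuous_map Z (cube n) g \<longleftrightarrow>
     (\<forall>i. continuous_map Z euclideanreal (\<lambda>z. g z i)) \<and> g \<in> topspace Z \<rightarrow> topspace (cube n)"
  unfolding cube_def Euclidean_space_def continuous_map_in_subtopology continuous_map_componentwise_UNIV
  by auto

lemma continuous_map_cube_coord: "continuous_map (cube n) euclideanreal (\<lambda>t. t i)"
  using continuous_map_into_cube[of "cube n" n id] by simp

text \<open>Bridge to the type class topology on functions, so that \<open>continuous_on\<close>
  facts can be used for maps on the cube.\<close>

lemma cube_eq_top_of_set: "cube n = top_of_set (topspace (cube n))"
  by (simp add: cube_def Euclidean_space_def euclidean_product_topology subtopology_subtopology)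

lemma cube_mapsD:
  assumes "f \<in> cube_maps n X x0"
  shows "continuous_map (cube n) X f" "\<And>t. t \<in> cube_boundary n \<Longrightarrow> f t = x0"
  using assms by (auto simp: cube_maps_def)

lemma cube_homotopic_iff:
  "cube_homotopic n X x0 f g \<longleftrightarrow>
     (\<exists>h. continuous_map (prod_topology (top_of_set {0..1::real}) (cube n)) X h \<and>
          (\<forall>t\<in>topspace (cube n). h (0, t) = f t) \<and> (\<forall>t\<in>topspace (cube n). h (1, t) = g t) \<and>
          (\<forall>s\<in>{0..1}. \<forall>t\<in>cube_boundary n. h (s, t) = x0))"
  unfolding cube_homotopic_def
  by (subst homotopic_with) (auto simp: cube_boundary_subset)

lemma cube_homotopic_imp_maps:
  assumes "cube_homotopic n X x0 f g"
  shows "f \<in> cube_maps n X x0" "g \<in> cube_maps n X x0"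
  using assms homotopic_with_imp_continuous_maps homotopic_with_imp_property
  unfolding cube_homotopic_def cube_maps_def by blast+

lemma cube_homotopic_equal:
  assumes "f \<in> cube_maps n X x0" "\<And>t. t \<in> topspace (cube n) \<Longrightarrow> f t = g t"
  shows "cube_homotopic n X x0 f g"
  unfolding cube_homotopic_def
proof (rule homotopic_with_equal)
  show "\<forall>t\<in>cube_boundary n. f t = x0"
    using cube_mapsD(2)[OF assms(1)] by blast
  then show "\<forall>t\<in>cube_boundary n. g t = x0"
    using assms(2) cube_boundary_subset by metis
qed (use cube_mapsD(1)[OF assms(1)] assms(2) in auto)

lemma cube_homotopic_sym: "cube_homotopic n X x0 f g \<longleftrightarrow> cube_homotopic n X x0 g f"
  unfolding cube_homotopic_def by (rule homotopic_with_sym)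

lemma cube_homotopic_trans:
  "cube_homotopic n X x0 f g \<Longrightarrow> cube_homotopic n X x0 g h \<Longrightarrow> cube_homotopic n X x0 f h"
  unfolding cube_homotopic_def by (rule homotopic_with_trans)

lemma cube_maps_const: "x0 \<in> topspace X \<Longrightarrow> (\<lambda>t. x0) \<in> cube_maps n X x0"
  by (simp add: cube_maps_def image_subset_iff)

lemma cube_class_eq_iff:
  assumes "f \<in> cube_maps n X x0" "g \<in> cube_maps n X x0"
  shows "cube_class n X x0 f = cube_class n X x0 g \<longleftrightarrow> cube_homotopic n X x0 f g"
proof
  assume eq: "cube_class n X x0 f = cube_class n X x0 g"
  have "g \<in> cube_class n X x0 g"
    using assms(2) cube_homotopic_equal[OF assms(2) refl] by (simp add: cube_class_def)
  then have "g \<in> cube_class n X x0 f" using eq by simp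
  then show "cube_homotopic n X x0 f g"
    by (simp add: cube_class_def)
next
  assume fg: "cube_homotopic n X x0 f g"
  have "cube_homotopic n X x0 f h \<longleftrightarrow> cube_homotopic n X x0 g h" for h
    using fg cube_homotopic_trans[of n X x0 f g h] cube_homotopic_trans[of n X x0 g f h]
      cube_homotopic_sym[of n X x0 f g] by metis
  then show "cube_class n X x0 f = cube_class n X x0 g"
    by (simp add: cube_class_def)
qed

lemma some_cube_class:
  assumes "f \<in> cube_maps n X x0"
  shows "cube_homotopic n X x0 f (SOME g. g \<in> cube_class n X x0 f)"
proof -
  have "f \<in> cube_class n X x0 f"
    using assms cube_homotopic_equal[of f n X x0 f] by (auto simp: cube_class_def)
  then have "(SOME g. g \<in> cube_class n X x0 f) \<in> cube_class n X x0 f"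
    by (rule someI[where P = "\<lambda>g. g \<in> cube_class n X x0 f"])
  then show ?thesis by (simp add: cube_class_def)
qed

text \<open>The parameter space \<open>T\<close> lets whole homotopies be concatenated. The two
  halves match at \<open>t 0 = 1/2\<close> because there both are evaluated on a face of the cube,
  where they equal \<open>x0\<close>.\<close>

lemma continuous_map_cube_concat:
  assumes h: "continuous_map (prod_topology T (cube n)) X h"
    and k: "continuous_map (prod_topology T (cube n)) X k"
    and h0: "\<And>s t. s \<in> topspace T \<Longrightarrow> t \<in> cube_boundary n \<Longrightarrow> h (s, t) = x0"
    and k0: "\<And>s t. s \<in> topspace T \<Longrightarrow> t \<in> cube_boundary n \<Longrightarrow> k (s, t) = x0"
    and n: "n \<ge> 1"
  shows "continuous_map (prod_topology T (cube n)) X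
           (\<lambda>z. cube_concat (\<lambda>u. h (fst z, u)) (\<lambda>u. k (fst z, u)) (snd z))"
proof -
  let ?Z = "prod_topology T (cube n)"
  have c: "continuous_map ?Z euclideanreal (\<lambda>z. snd z i)" for i
    using continuous_map_compose[OF continuous_map_snd continuous_map_cube_coord, of T n i]
    by (simp add: o_def)
  \<comment> \<open>Affine stretching of coordinate 0 is continuous into the cube on any set
    \<open>S\<close> where it stays within [0,1]; the two halves use \<open>2 * a\<close> and
    \<open>2 * a - 1\<close>.\<close>
  have upd: "continuous_map (subtopology ?Z S) ?Z (\<lambda>z. (fst z, (snd z)(0 := a * snd z 0 + b)))"
    if "\<And>z. z \<in> topspace ?Z \<Longrightarrow> z \<in> S \<Longrightarrow> 0 \<le> a * snd z 0 + b \<and> a * snd z 0 + b \<le> 1" for S a b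
  proof -
    have "continuous_map (subtopology ?Z S) (cube n) (\<lambda>z. (snd z)(0 := a * snd z 0 + b))"
      unfolding continuous_map_into_cube
    proof (intro conjI allI)
      fix i
      have "continuous_map ?Z euclideanreal (\<lambda>z. a * snd z 0 + b)"
        by (intro continuous_intros c)
      then show "continuous_map (subtopology ?Z S) euclideanreal (\<lambda>z. ((snd z)(0 := a * snd z 0 + b)) i)"
        by (cases "i = 0") (auto intro: continuous_map_from_subtopology c)
    next
      show "(\<lambda>z. (snd z)(0 := a * snd z 0 + b)) \<in> topspace (subtopology ?Z S) \<rightarrow> topspace (cube n)"
        using that n by (auto intro!: mem_cube_update)
    qed
    then show ?thesis
      by (auto simp: continuous_map_pairwise o_def intro: continuous_map_from_subtopology continuous_map_fst)
  qed
  have "continuous_map ?Z X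
    (\<lambda>z. if snd z 0 \<le> 1/2 then h (fst z, (snd z)(0 := 2 * snd z 0)) else k (fst z, (snd z)(0 := 2 * snd z 0 - 1)))"
  proof (rule continuous_map_cases_le[OF c])
    show "continuous_map ?Z euclideanreal (\<lambda>z. 1/2)" by simp
    show "continuous_map (subtopology ?Z {z \<in> topspace ?Z. snd z 0 \<le> 1/2}) X
            (\<lambda>z. h (fst z, (snd z)(0 := 2 * snd z 0)))"
      using continuous_map_compose[OF upd[of "{z \<in> topspace ?Z. snd z 0 \<le> 1/2}" 2 0] h] n
      by (auto simp: o_def mem_cube)
    show "continuous_map (subtopology ?Z {z \<in> topspace ?Z. 1/2 \<le> snd z 0}) X
            (\<lambda>z. k (fst z, (snd z)(0 := 2 * snd z 0 - 1)))"
      using continuous_map_compose[OF upd[of "{z \<in> topspace ?Z. 1/2 \<le> snd z 0}" 2 "-1"] k] n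
      by (auto simp: o_def mem_cube)
    fix z assume z: "z \<in> topspace ?Z" "snd z 0 = 1/2"
    then show "h (fst z, (snd z)(0 := 2 * snd z 0)) = k (fst z, (snd z)(0 := 2 * snd z 0 - 1))"
      using h0[of "fst z"] k0[of "fst z"] cube_boundary_update[of "snd z" n] n by auto
  qed
  then show ?thesis by (simp add: cube_concat_def)
qed

lemma cube_concat_boundary:
  assumes "\<And>u. u \<in> cube_boundary n \<Longrightarrow> f u = x0" "\<And>u. u \<in> cube_boundary n \<Longrightarrow> g u = x0"
    and t: "t \<in> cube_boundary n" and n: "n \<ge> 1"
  shows "cube_concat f g t = x0"
proof -
  have t': "t \<in> topspace (cube n)" "0 \<le> t 0" "t 0 \<le> 1"
    using t n cube_boundary_subset[OF t] by (auto simp: mem_cube)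
  have "t 0 = 0 \<or> t 0 = 1 \<or> (t 0 \<noteq> 0 \<and> t 0 \<noteq> 1)" by auto
  then show ?thesis
    using assms cube_boundary_update[OF t'(1) n] cube_boundary_update_other[OF t _ _ n] t'
    by (elim disjE) (auto simp: cube_concat_def)
qed

lemma cube_homotopic_concat:
  assumes "cube_homotopic n X x0 f f'" "cube_homotopic n X x0 g g'" and n: "n \<ge> 1"
  shows "cube_homotopic n X x0 (cube_concat f g) (cube_concat f' g')"
proof -
  obtain h where h: "continuous_map (prod_topology (top_of_set {0..1::real}) (cube n)) X h"
      "\<And>t. t\<in>topspace (cube n) \<Longrightarrow> h (0, t) = f t" "\<And>t. t\<in>topspace (cube n) \<Longrightarrow> h (1, t) = f' t"
      "\<And>s t. s\<in>{0..1} \<Longrightarrow> t\<in>cube_boundary n \<Longrightarrow> h (s, t) = x0"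
    using assms(1) unfolding cube_homotopic_iff by blast
  obtain k where k: "continuous_map (prod_topology (top_of_set {0..1::real}) (cube n)) X k"
      "\<And>t. t\<in>topspace (cube n) \<Longrightarrow> k (0, t) = g t" "\<And>t. t\<in>topspace (cube n) \<Longrightarrow> k (1, t) = g' t"
      "\<And>s t. s\<in>{0..1} \<Longrightarrow> t\<in>cube_boundary n \<Longrightarrow> k (s, t) = x0"
    using assms(2) unfolding cube_homotopic_iff by blast
  show ?thesis
    unfolding cube_homotopic_iff
  proof (intro exI conjI ballI)
    show "continuous_map (prod_topology (top_of_set {0..1::real}) (cube n)) X
       (\<lambda>z. cube_concat (\<lambda>u. h (fst z, u)) (\<lambda>u. k (fst z, u)) (snd z))"
      by (rule continuous_map_cube_concat[OF h(1) k(1) _ _ n]) (use h(4) k(4) in auto)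
  next
    fix t assume t: "t \<in> topspace (cube n)"
    then have t': "0 \<le> t 0" "t 0 \<le> 1" using n by (auto simp: mem_cube)
    have u: "t(0 := 2 * t 0) \<in> topspace (cube n)" if "t 0 \<le> 1/2"
      using mem_cube_update[OF t n, of "2 * t 0"] t' that by auto
    have v: "t(0 := 2 * t 0 - 1) \<in> topspace (cube n)" if "\<not> t 0 \<le> 1/2"
      using mem_cube_update[OF t n, of "2 * t 0 - 1"] t' that by auto
    show "cube_concat (\<lambda>u. h (fst (0, t), u)) (\<lambda>u. k (fst (0, t), u)) (snd (0, t)) = cube_concat f g t"
         "cube_concat (\<lambda>u. h (fst (1, t), u)) (\<lambda>u. k (fst (1, t), u)) (snd (1, t)) = cube_concat f' g' t"
      using u v h k by (auto simp: cube_concat_def)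
  next
    fix s :: real and t assume "s \<in> {0..1}" "t \<in> cube_boundary n"
    then show "cube_concat (\<lambda>u. h (fst (s, t), u)) (\<lambda>u. k (fst (s, t), u)) (snd (s, t)) = x0"
      using h(4) k(4) n by (auto intro!: cube_concat_boundary)
  qed
qed

text \<open>Obtained from homotopy invariance applied to reflexive homotopies, since homotopic maps
  are admissible.\<close>

lemma cube_concat_in_maps:
  assumes "f \<in> cube_maps n X x0" "g \<in> cube_maps n X x0" "n \<ge> 1"
  shows "cube_concat f g \<in> cube_maps n X x0"
  using cube_homotopic_concat[OF cube_homotopic_equal[OF assms(1) refl] cube_homotopic_equal[OF assms(2) refl] assms(3)]
  by (rule cube_homotopic_imp_maps(1))

text \<open>The straight line from \<open>\<phi>\<close> to \<open>\<psi>\<close> in coordinate 0 is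
  the homotopy; every group axiom below reduces to it. The common end values are 0 or 1, so boundary
  points stay on the boundary at all times. With \<open>\<phi> = \<psi>\<close> it also shows that a
  reparametrised map is admissible.\<close>

lemma cube_homotopic_reparam:
  assumes f: "f \<in> cube_maps n X x0" and n: "n \<ge> 1"
    and \<phi>: "continuous_on {0..1} \<phi>" "\<And>a. a \<in> {0..1} \<Longrightarrow> \<phi> a \<in> {0..1}"
    and \<psi>: "continuous_on {0..1} \<psi>" "\<And>a. a \<in> {0..1} \<Longrightarrow> \<psi> a \<in> {0..1}"
    and 0: "\<phi> 0 = \<psi> 0" "\<phi> 0 = 0 \<or> \<phi> 0 = (1::real)"
    and 1: "\<phi> 1 = \<psi> 1" "\<phi> 1 = 0 \<or> \<phi> 1 = (1::real)"
  shows "cube_homotopic n X x0 (\<lambda>t. f (t(0 := \<phi> (t 0)))) (\<lambda>t. f (t(0 := \<psi> (t 0))))"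
  unfolding cube_homotopic_iff
proof (intro exI conjI ballI)
  let ?Z = "prod_topology (top_of_set {0..1::real}) (cube n)"
  let ?H = "\<lambda>z. (snd z)(0 := (1 - fst z) * \<phi> (snd z 0) + fst z * \<psi> (snd z 0))"
  have c: "continuous_map ?Z euclideanreal (\<lambda>z. snd z i)" for i
    using continuous_map_compose[OF continuous_map_snd continuous_map_cube_coord, of "top_of_set {0..1::real}" n i]
    by (simp add: o_def)
  have d: "continuous_map ?Z euclideanreal fst"
    by (rule continuous_map_into_fulltopology) (rule continuous_map_fst)
  have c0: "continuous_map ?Z (top_of_set {0..1::real}) (\<lambda>z. snd z 0)"
    using c n by (auto simp: continuous_map_in_subtopology mem_cube)
  have cc: "continuous_map ?Z euclideanreal (\<lambda>z. \<xi> (snd z 0))" if "continuous_on {0..1} \<xi>" for \<xi> :: "real \<Rightarrow> real"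
    using continuous_map_compose[OF c0, of euclideanreal \<xi>] that by (simp add: o_def)
  have conv: "0 \<le> (1 - s) * a + s * b \<and> (1 - s) * a + s * b \<le> 1"
    if "s \<in> {0..1}" "a \<in> {0..1}" "b \<in> {0..1}" for s a b :: real
    using that convex_bound_le[of a 1 b "1 - s" s] by auto
  have mem: "t(0 := (1 - s) * \<phi> (t 0) + s * \<psi> (t 0)) \<in> topspace (cube n)"
    if "s \<in> {0..1}" "t \<in> topspace (cube n)" for s t
    using that n conv[OF that(1) \<phi>(2) \<psi>(2), of "t 0" "t 0"]
    by (intro mem_cube_update) (auto simp: mem_cube)
  have "continuous_map ?Z (cube n) ?H"
    unfolding continuous_map_into_cube
  proof (intro conjI allI)
    fix i
    have "continuous_map ?Z euclideanreal (\<lambda>z. (1 - fst z) * \<phi> (snd z 0) + fst z * \<psi> (snd z 0))"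
      by (intro continuous_intros d cc \<phi> \<psi>)
    then show "continuous_map ?Z euclideanreal (\<lambda>z. ?H z i)"
      using c by (cases "i = 0") auto
  qed (use mem in auto)
  from continuous_map_compose[OF this cube_mapsD(1)[OF f]]
  show "continuous_map ?Z X (\<lambda>z. f (?H z))" by (simp add: o_def)
next
  fix s :: real and t assume s: "s \<in> {0..1}" and t: "t \<in> cube_boundary n"
  have t': "t \<in> topspace (cube n)" "0 \<le> t 0" "t 0 \<le> 1"
    using t n cube_boundary_subset[OF t] by (auto simp: mem_cube)
  have conv: "0 \<le> (1 - s) * a + s * b \<and> (1 - s) * a + s * b \<le> 1"
    if "a \<in> {0..1}" "b \<in> {0..1}" for a b :: real
    using that s convex_bound_le[of a 1 b "1 - s" s] by auto
  \<comment> \<open>On the faces \<open>t 0 = 0\<close> and \<open>t 0 = 1\<close> both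
    reparametrisations agree, so the straight line is stationary and remains at 0 or 1.\<close>
  have same: "(1 - s) * a + s * a = a" for a by (simp add: algebra_simps)
  have "t(0 := (1 - s) * \<phi> (t 0) + s * \<psi> (t 0)) \<in> cube_boundary n"
  proof (cases "t 0 = 0 \<or> t 0 = 1")
    case True
    then show ?thesis
      using 0 1 same by (intro cube_boundary_update[OF t'(1) n]) auto
  next
    case False
    then show ?thesis
      using conv[OF \<phi>(2) \<psi>(2), of "t 0" "t 0"] t' by (intro cube_boundary_update_other[OF t _ _ n]) auto
  qed
  then show "f ((snd (s,t))(0 := (1 - fst (s,t)) * \<phi> (snd (s,t) 0) + fst (s,t) * \<psi> (snd (s,t) 0))) = x0"
    using cube_mapsD(2)[OF f] by simp
qed auto

corollary cube_homotopic_reparam_id: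
  assumes "f \<in> cube_maps n X x0" "n \<ge> 1" "continuous_on {0..1} \<phi>"
    "\<And>a. a \<in> {0..1} \<Longrightarrow> \<phi> a \<in> {0..1}" "\<phi> 0 = 0" "\<phi> 1 = (1::real)"
  shows "cube_homotopic n X x0 (\<lambda>t. f (t(0 := \<phi> (t 0)))) f"
  using cube_homotopic_reparam[OF assms(1-4), of "\<lambda>a. a"] assms(5,6) by simp

section \<open>The group structure on homotopy classes of cube maps\<close>

lemma carrier_homotopy_group: "carrier (homotopy_group n X x0) = cube_class n X x0 ` cube_maps n X x0"
  and one_homotopy_group: "\<one>\<^bsub>homotopy_group n X x0\<^esub> = cube_class n X x0 (\<lambda>t. x0)"
  by (simp_all add: homotopy_group_def)

text \<open>The product is defined through representatives picked by \<open>SOME\<close>; invariance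
  of concatenation under homotopy replaces them by \<open>f\<close> and \<open>g\<close>.\<close>

lemma mult_homotopy_group:
  assumes "f \<in> cube_maps n X x0" "g \<in> cube_maps n X x0" "n \<ge> 1"
  shows "cube_class n X x0 f \<otimes>\<^bsub>homotopy_group n X x0\<^esub> cube_class n X x0 g = cube_class n X x0 (cube_concat f g)"
proof -
  let ?f = "SOME h. h \<in> cube_class n X x0 f" and ?g = "SOME h. h \<in> cube_class n X x0 g"
  have h: "cube_homotopic n X x0 (cube_concat f g) (cube_concat ?f ?g)"
    using assms by (intro cube_homotopic_concat some_cube_class)
  then have "cube_class n X x0 (cube_concat f g) = cube_class n X x0 (cube_concat ?f ?g)"
    by (simp add: cube_class_eq_iff cube_homotopic_imp_maps[OF h])
  then show ?thesis by (simp add: homotopy_group_def)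
qed

lemma group_homotopy_group:
  assumes x0: "x0 \<in> topspace X" and n: "n \<ge> 1"
  shows "group (homotopy_group n X x0)"
proof (rule groupI)
  let ?G = "homotopy_group n X x0" and ?C = "cube_class n X x0" and ?M = "cube_maps n X x0"
  have bdry: "f (t(0 := a)) = x0" if "f \<in> ?M" "t \<in> topspace (cube n)" "a = 0 \<or> a = 1" for f t a
    using cube_mapsD(2)[OF that(1) cube_boundary_update[OF that(2) n that(3)]] .
  show "\<one>\<^bsub>?G\<^esub> \<in> carrier ?G"
    using cube_maps_const[OF x0] by (auto simp: carrier_homotopy_group one_homotopy_group)
  fix A assume "A \<in> carrier ?G"
  then obtain f where f: "f \<in> ?M" "A = ?C f" by (auto simp: carrier_homotopy_group)
  have "cube_homotopic n X x0 (cube_concat (\<lambda>t. x0) f) f"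
  proof (rule cube_homotopic_trans)
    \<comment> \<open>\<open>max 0 (2 * a - 1)\<close> waits at 0 on the first half, where
      \<open>f\<close> is \<open>x0\<close>, and then runs through [0,1] at double speed: this is
      the constant map followed by \<open>f\<close>.\<close>
    show "cube_homotopic n X x0 (cube_concat (\<lambda>t. x0) f) (\<lambda>t. f (t(0 := max 0 (2 * t 0 - 1))))"
      using bdry[OF f(1)] by (intro cube_homotopic_equal cube_concat_in_maps f n cube_maps_const x0)
        (auto simp: cube_concat_def max_def)
    show "cube_homotopic n X x0 (\<lambda>t. f (t(0 := max 0 (2 * t 0 - 1)))) f"
      by (rule cube_homotopic_reparam_id[OF f(1) n, of "\<lambda>a. max 0 (2 * a - 1)"])
        (auto intro!: continuous_intros)
  qed
  then show "\<one>\<^bsub>?G\<^esub> \<otimes>\<^bsub>?G\<^esub> A = A"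
    using f n x0 by (simp add: one_homotopy_group mult_homotopy_group cube_class_eq_iff
      cube_concat_in_maps cube_maps_const)
  let ?r = "\<lambda>t. f (t(0 := 1 - t 0))"
  have r: "?r \<in> ?M"
    by (rule cube_homotopic_imp_maps(1),
        rule cube_homotopic_reparam[OF f(1) n, of "\<lambda>a. 1 - a" "\<lambda>a. 1 - a"])
      (auto intro!: continuous_intros)
  have abs1: "\<bar>2 * a - 1\<bar> = 1 - 2 * a" if "a \<le> 1/2" for a :: real
    using that by auto
  have abs2: "\<bar>2 * a - 1\<bar> = 2 * a - 1" if "\<not> a \<le> 1/2" for a :: real
    using that by auto
  \<comment> \<open>Reversed \<open>f\<close> followed by \<open>f\<close> is \<open>f\<close> along
    the path \<open>\<bar>2 * a - 1\<bar>\<close>, which goes from 1 to 0 and back to 1. With ends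
    fixed it deforms to the constant path at 1, where \<open>f\<close> is \<open>x0\<close>.\<close>
  have "cube_homotopic n X x0 (cube_concat ?r f) (\<lambda>t. x0)"
  proof (rule cube_homotopic_trans)
    show "cube_homotopic n X x0 (cube_concat ?r f) (\<lambda>t. f (t(0 := \<bar>2 * t 0 - 1\<bar>)))"
      using f r by (intro cube_homotopic_equal cube_concat_in_maps n)
        (auto simp: cube_concat_def abs1 abs2)
    show "cube_homotopic n X x0 (\<lambda>t. f (t(0 := \<bar>2 * t 0 - 1\<bar>))) (\<lambda>t. x0)"
    proof (rule cube_homotopic_trans)
      show *: "cube_homotopic n X x0 (\<lambda>t. f (t(0 := \<bar>2 * t 0 - 1\<bar>))) (\<lambda>t. f (t(0 := 1)))"
        by (rule cube_homotopic_reparam[OF f(1) n, of "\<lambda>a. \<bar>2 * a - 1\<bar>" "\<lambda>a. 1"])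
          (auto intro!: continuous_intros)
      show "cube_homotopic n X x0 (\<lambda>t. f (t(0 := 1))) (\<lambda>t. x0)"
        using bdry[OF f(1)] by (intro cube_homotopic_equal cube_homotopic_imp_maps(2)[OF *]) auto
    qed
  qed
  then have "?C ?r \<otimes>\<^bsub>?G\<^esub> A = \<one>\<^bsub>?G\<^esub>"
    using f r n x0 by (simp add: one_homotopy_group mult_homotopy_group cube_class_eq_iff
      cube_concat_in_maps cube_maps_const)
  then show "\<exists>B\<in>carrier ?G. B \<otimes>\<^bsub>?G\<^esub> A = \<one>\<^bsub>?G\<^esub>"
    using r by (auto simp: carrier_homotopy_group)
  fix B assume "B \<in> carrier ?G"
  then obtain g where g: "g \<in> ?M" "B = ?C g" by (auto simp: carrier_homotopy_group)
  show "A \<otimes>\<^bsub>?G\<^esub> B \<in> carrier ?G"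
    using f g n by (auto simp: mult_homotopy_group carrier_homotopy_group cube_concat_in_maps)
  fix C assume "C \<in> carrier ?G"
  then obtain h where h: "h \<in> ?M" "C = ?C h" by (auto simp: carrier_homotopy_group)
  have "cube_homotopic n X x0 (cube_concat (cube_concat f g) h) (cube_concat f (cube_concat g h))"
  proof (rule cube_homotopic_trans)
    \<comment> \<open>The standard change of breakpoints from 1/4, 1/2 to 1/2, 3/4 has slopes 2, 1,
      1/2. It is concave, hence a minimum of its three linear pieces, which makes its continuity
      immediate.\<close>
    show "cube_homotopic n X x0 (cube_concat (cube_concat f g) h)
      (\<lambda>t. cube_concat f (cube_concat g h) (t(0 := min (2 * t 0) (min (t 0 + 1/4) ((t 0 + 1) / 2)))))"
    proof (intro cube_homotopic_equal cube_concat_in_maps f g h n)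
      fix t :: "nat \<Rightarrow> real"
      show "cube_concat (cube_concat f g) h t = cube_concat f (cube_concat g h)
          (t(0 := min (2 * t 0) (min (t 0 + 1/4) ((t 0 + 1) / 2))))"
      proof -
        consider "t 0 \<le> 1/4" | "1/4 < t 0" "t 0 \<le> 1/2" | "1/2 < t 0" by linarith
        then show ?thesis
        proof cases
          case 1
          then have "min (2 * t 0) (min (t 0 + 1/4) ((t 0 + 1) / 2)) = 2 * t 0" by simp
          with 1 show ?thesis by (simp add: cube_concat_def)
        next
          case 2
          then have "min (2 * t 0) (min (t 0 + 1/4) ((t 0 + 1) / 2)) = t 0 + 1/4" by simp
          with 2 show ?thesis by (simp add: cube_concat_def)
        next
          case 3
          then have "min (2 * t 0) (min (t 0 + 1/4) ((t 0 + 1) / 2)) = (t 0 + 1) / 2" by simp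
          moreover have "2 * (2 * ((t 0 + 1) / 2) - 1) - 1 = 2 * t 0 - 1" by simp
          ultimately show ?thesis using 3 by (simp add: cube_concat_def del: distrib_left_numeral right_diff_distrib_numeral)
        qed
      qed
    qed
    show "cube_homotopic n X x0
      (\<lambda>t. cube_concat f (cube_concat g h) (t(0 := min (2 * t 0) (min (t 0 + 1/4) ((t 0 + 1) / 2)))))
      (cube_concat f (cube_concat g h))"
      by (rule cube_homotopic_reparam_id[of _ n X x0 "\<lambda>a. min (2 * a) (min (a + 1/4) ((a + 1) / 2))"])
        (use f g h n in \<open>auto intro!: continuous_intros cube_concat_in_maps simp: min_le_iff_disj\<close>)
  qed
  then show "(A \<otimes>\<^bsub>?G\<^esub> B) \<otimes>\<^bsub>?G\<^esub> C = A \<otimes>\<^bsub>?G\<^esub> (B \<otimes>\<^bsub>?G\<^esub> C)"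
    using f g h n by (simp add: mult_homotopy_group cube_class_eq_iff cube_concat_in_maps)
qed

section \<open>The quotient maps from the cube onto the spheres\<close>

text \<open>The sup norm after recentring the cube to [-1,1]^n. It serves as radial parameter: 0 at
  the centre, 1 exactly on the boundary, and \<open>pi\<close> times it is the polar angle on the
  sphere. The Euclidean \<open>cube_norm\<close> only normalises the direction.\<close>

definition cube_maxnorm :: "nat \<Rightarrow> (nat \<Rightarrow> real) \<Rightarrow> real" where
  "cube_maxnorm n t = Max ((\<lambda>i. \<bar>2 * t i - 1\<bar>) ` {..<n})"

definition cube_norm :: "nat \<Rightarrow> (nat \<Rightarrow> real) \<Rightarrow> real" where
  "cube_norm n t = sqrt (\<Sum>i<n. (2 * t i - 1)\<^sup>2)"

text \<open>The separate case for the centre of the cube is absorbed, since division by 0 gives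
  0.\<close>

lemma cube_to_sphere_nth:
  "cube_to_sphere n k t j =
     (if j = 0 then (1 + cos (pi * cube_maxnorm n t)) / real k
      else if j \<le> n then sin (pi * cube_maxnorm n t) * (2 * t (j - 1) - 1) / (real k * cube_norm n t)
      else 0)"
  by (simp add: cube_to_sphere_def cube_maxnorm_def cube_norm_def Let_def image_image)

lemma le_cube_maxnorm: "i < n \<Longrightarrow> \<bar>2 * t i - 1\<bar> \<le> cube_maxnorm n t"
  unfolding cube_maxnorm_def by (rule Max_ge) auto

lemma cube_maxnorm_attained: "n \<ge> 1 \<Longrightarrow> \<exists>i<n. cube_maxnorm n t = \<bar>2 * t i - 1\<bar>"
proof -
  assume "n \<ge> 1"
  then have "cube_maxnorm n t \<in> (\<lambda>i. \<bar>2 * t i - 1\<bar>) ` {..<n}"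
    unfolding cube_maxnorm_def by (intro Max_in) (auto simp: lessThan_empty_iff)
  then show ?thesis by auto
qed

lemma cube_maxnorm_nonneg: "n \<ge> 1 \<Longrightarrow> 0 \<le> cube_maxnorm n t"
  using cube_maxnorm_attained[of n t] by auto

lemma cube_maxnorm_le_1: "n \<ge> 1 \<Longrightarrow> t \<in> topspace (cube n) \<Longrightarrow> cube_maxnorm n t \<le> 1"
proof -
  assume n: "n \<ge> 1" and t: "t \<in> topspace (cube n)"
  obtain i where "i < n" "cube_maxnorm n t = \<bar>2 * t i - 1\<bar>" using cube_maxnorm_attained[OF n] by blast
  with t show ?thesis by (auto simp: mem_cube abs_le_iff)
qed

lemma cube_boundary_iff:
  assumes "n \<ge> 1" "t \<in> topspace (cube n)"
  shows "t \<in> cube_boundary n \<longleftrightarrow> cube_maxnorm n t = 1"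
proof
  assume "t \<in> cube_boundary n"
  then obtain i where "i < n" "t i = 0 \<or> t i = 1" by (auto simp: cube_boundary_def)
  then show "cube_maxnorm n t = 1"
    using le_cube_maxnorm[of i n t] cube_maxnorm_le_1[OF assms] by auto
next
  assume *: "cube_maxnorm n t = 1"
  obtain i where "i < n" "cube_maxnorm n t = \<bar>2 * t i - 1\<bar>"
    using cube_maxnorm_attained[OF assms(1)] by blast
  with * assms(2) show "t \<in> cube_boundary n"
    by (auto simp: cube_boundary_def abs_if split: if_splits)
qed

lemma cube_maxnorm_le_norm: "n \<ge> 1 \<Longrightarrow> cube_maxnorm n t \<le> cube_norm n t"
proof -
  assume n: "n \<ge> 1"
  obtain i where i: "i < n" "cube_maxnorm n t = \<bar>2 * t i - 1\<bar>" using cube_maxnorm_attained[OF n] by blast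
  have "(2 * t i - 1)\<^sup>2 \<le> (\<Sum>i<n. (2 * t i - 1)\<^sup>2)"
    using i by (intro member_le_sum) auto
  then show ?thesis
    using i by (auto simp: cube_norm_def intro!: real_le_rsqrt)
qed

lemma abs_le_cube_norm: "i < n \<Longrightarrow> \<bar>2 * t i - 1\<bar> \<le> cube_norm n t"
  using le_cube_maxnorm[of i n t] cube_maxnorm_le_norm[of n t] by linarith

lemma cube_norm_sq: "(cube_norm n t)\<^sup>2 = (\<Sum>i<n. (2 * t i - 1)\<^sup>2)"
  by (simp add: cube_norm_def sum_nonneg)

lemma cube_norm_zero: "cube_norm n t = 0 \<Longrightarrow> i < n \<Longrightarrow> t i = 1/2"
  using abs_le_cube_norm[of i n t] by simp

lemma cube_norm_eq_0_iff: "n \<ge> 1 \<Longrightarrow> cube_norm n t = 0 \<longleftrightarrow> cube_maxnorm n t = 0"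
proof
  assume n: "n \<ge> 1" and "cube_norm n t = 0"
  then show "cube_maxnorm n t = 0"
    using cube_maxnorm_nonneg[OF n, of t] cube_maxnorm_le_norm[OF n, of t] by simp
next
  assume n: "n \<ge> 1" and 0: "cube_maxnorm n t = 0"
  have "2 * t i - 1 = 0" if "i < n" for i
    using le_cube_maxnorm[OF that, of t] 0 by simp
  then show "cube_norm n t = 0"
    by (simp add: cube_norm_def)
qed

lemma cube_to_sphere_boundary:
  assumes "n \<ge> 1" "t \<in> cube_boundary n"
  shows "cube_to_sphere n k t = hawaiian_base"
  using cube_boundary_iff[OF assms(1) cube_boundary_subset[OF assms(2)]] assms(2)
  by (auto simp: cube_to_sphere_nth hawaiian_base_def fun_eq_iff)

text \<open>This is \<open>cos^2 + sin^2 = 1\<close> scaled by \<open>1 / k\<close>. At the centre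
  the direction is 0, but there the sine vanishes as well. For \<open>k = 0\<close> all quotients
  are 0 and the point is the origin.\<close>

lemma cube_to_sphere_in_hsphere:
  assumes "n \<ge> 1"
  shows "cube_to_sphere n k t \<in> hsphere n k"
proof (cases "k = 0")
  case True
  then show ?thesis by (auto simp: hsphere_def cube_to_sphere_nth)
next
  case False
  let ?m = "cube_maxnorm n t" and ?e = "cube_norm n t"
  have "(\<Sum>i\<in>{1..n}. (cube_to_sphere n k t i)\<^sup>2) = (\<Sum>i<n. (sin (pi * ?m) * (2 * t i - 1) / (real k * ?e))\<^sup>2)"
    by (rule sum.reindex_bij_witness[of _ Suc "\<lambda>i. i - 1"]) (auto simp: cube_to_sphere_nth)
  also have "\<dots> = (sin (pi * ?m))\<^sup>2 / (real k * ?e)\<^sup>2 * ?e\<^sup>2"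
    by (simp add: cube_norm_sq power_mult_distrib power_divide sum_distrib_left)
  also have "\<dots> = (sin (pi * ?m))\<^sup>2 / (real k)\<^sup>2"
    using cube_norm_eq_0_iff[OF assms, of t] by (cases "?e = 0") (auto simp: power_mult_distrib)
  finally have "(\<Sum>i\<in>{1..n}. (cube_to_sphere n k t i)\<^sup>2) = (sin (pi * ?m))\<^sup>2 / (real k)\<^sup>2" .
  moreover have "cube_to_sphere n k t 0 - 1 / real k = cos (pi * ?m) / real k"
    by (simp add: cube_to_sphere_nth add_divide_distrib)
  ultimately show ?thesis
    by (simp add: hsphere_def cube_to_sphere_nth power_divide flip: add_divide_distrib)
qed

lemma continuous_on_Max_image:
  fixes f :: "'i \<Rightarrow> 'b::topological_space \<Rightarrow> real"
  assumes "finite I" "I \<noteq> {}" "\<And>i. i \<in> I \<Longrightarrow> continuous_on S (f i)"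
  shows "continuous_on S (\<lambda>x. Max ((\<lambda>i. f i x) ` I))"
  using assms by (induction I rule: finite_ne_induct) (auto intro: continuous_on_max)

lemma continuous_on_coord: "continuous_on S (\<lambda>t::nat \<Rightarrow> real. t i)"
  by (rule continuous_on_product_then_coordinatewise) (rule continuous_on_id)

lemma continuous_on_cube_maxnorm: "n \<ge> 1 \<Longrightarrow> continuous_on S (cube_maxnorm n)"
  unfolding cube_maxnorm_def
  by (intro continuous_on_Max_image) (auto intro!: continuous_intros continuous_on_coord simp: lessThan_empty_iff)

lemma continuous_on_cube_norm: "continuous_on S (cube_norm n)"
  unfolding cube_norm_def by (intro continuous_intros continuous_on_coord)

text \<open>Only the centre of the cube is delicate, where the direction has no limit. The direction
  stays bounded while the sine factor tends to 0, so the product tends to 0, its value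
  there.\<close>

lemma continuous_on_cube_to_sphere:
  assumes n: "n \<ge> 1"
  shows "continuous_on UNIV (cube_to_sphere n k)"
proof (rule continuous_on_coordinatewise_then_product)
  fix j
  let ?m = "cube_maxnorm n" and ?e = "cube_norm n"
  have m: "isCont ?m t" and e: "isCont ?e t" for t
    using continuous_on_cube_maxnorm[OF n, of UNIV] continuous_on_cube_norm[of UNIV n]
    by (auto simp: continuous_on_eq_continuous_at)
  have c: "isCont (\<lambda>t. t i) t" for t :: "nat \<Rightarrow> real" and i
    using continuous_on_coord[of UNIV i] continuous_on_eq_continuous_at[OF open_UNIV] by blast
  show "continuous_on UNIV (\<lambda>t. cube_to_sphere n k t j)"
  proof (cases "j = 0 \<or> j > n \<or> k = 0")
    case True
    then consider "k = 0" | "j = 0" "k \<noteq> 0" | "j > n" by auto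
    then show ?thesis
    proof cases
      case 1
      then have "(\<lambda>t. cube_to_sphere n k t j) = (\<lambda>t. 0)" by (simp add: cube_to_sphere_nth fun_eq_iff)
      then show ?thesis by (simp only: continuous_on_const)
    next
      case 2
      then have "(\<lambda>t. cube_to_sphere n k t j) = (\<lambda>t. (1 + cos (pi * ?m t)) / real k)"
        by (simp add: cube_to_sphere_nth fun_eq_iff)
      then show ?thesis
        using 2 by (simp only:) (intro continuous_intros continuous_on_cube_maxnorm[OF n], auto)
    next
      case 3
      then have "(\<lambda>t. cube_to_sphere n k t j) = (\<lambda>t. 0)" by (simp add: cube_to_sphere_nth fun_eq_iff)
      then show ?thesis by (simp only: continuous_on_const)
    qed
  next
    case False
    have "isCont (\<lambda>t. sin (pi * ?m t) * (2 * t (j - 1) - 1) / (real k * ?e t)) t" for t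
    proof (cases "?e t = 0")
      case nz: False
      then show ?thesis using False by (intro continuous_intros m e c) auto
    next
      case True
      then have mt: "?m t = 0" using cube_norm_eq_0_iff[OF n] by blast
      have lim: "(\<lambda>s. sin (pi * ?m s)) \<midarrow>t\<rightarrow> 0"
        using isCont_sin' [OF continuous_mult[OF continuous_const m[of t]], of pi] mt
        by (simp add: isCont_def)
      \<comment> \<open>Each recentred coordinate is at most the Euclidean norm in absolute value,
        and \<open>k\<close> is at least 1, so the direction factor is at most 1.\<close>
      have bd: "norm (sin (pi * ?m s) * (2 * s (j - 1) - 1) / (real k * ?e s)) \<le> norm (sin (pi * ?m s)) * 1" for s
      proof -
        have "\<bar>2 * s (j - 1) - 1\<bar> \<le> ?e s" using False by (intro abs_le_cube_norm) auto
        moreover have "1 \<le> real k" using False by simp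
        ultimately have *: "\<bar>2 * s (j - 1) - 1\<bar> \<le> real k * ?e s"
          by (smt (verit) mult_le_cancel_right1)
        have "\<bar>2 * s (j - 1) - 1\<bar> / (real k * ?e s) \<le> 1"
        proof (cases "real k * ?e s = 0")
          case nz: False
          have "0 \<le> real k * ?e s" by (simp add: cube_norm_def sum_nonneg)
          then have "0 < real k * ?e s" using nz by linarith
          with * show ?thesis by (simp only: divide_le_eq_1_pos)
        qed (simp only: div_by_0 zero_le_one)
        then have "\<bar>sin (pi * ?m s)\<bar> * (\<bar>2 * s (j - 1) - 1\<bar> / (real k * ?e s)) \<le> \<bar>sin (pi * ?m s)\<bar> * 1"
          by (intro mult_left_mono) auto
        moreover have "0 \<le> ?e s" by (simp add: cube_norm_def sum_nonneg)
        ultimately show ?thesis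
          by (simp add: abs_mult)
      qed
      have "(\<lambda>s. sin (pi * ?m s) * (2 * s (j - 1) - 1) / (real k * ?e s)) \<midarrow>t\<rightarrow> 0"
        by (rule tendsto_0_le[OF lim, of _ 1]) (use bd in auto)
      then show ?thesis using mt by (simp add: isCont_def)
    qed
    then show ?thesis
      using False by (simp add: cube_to_sphere_nth continuous_at_imp_continuous_on)
  qed
qed

text \<open>Coordinate 0 determines the sup norm, as the cosine is injective on [0, pi]. Away from
  the centre and the boundary the other coordinates determine the direction, and a point is fixed by
  its direction and sup norm.\<close>

lemma cube_to_sphere_inj:
  assumes n: "n \<ge> 1" and k: "k \<ge> 1" and s: "s \<in> topspace (cube n)" and t: "t \<in> topspace (cube n)"
    and eq: "cube_to_sphere n k s = cube_to_sphere n k t"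
  shows "s = t \<or> (s \<in> cube_boundary n \<and> t \<in> cube_boundary n)"
proof -
  let ?m = "cube_maxnorm n" and ?e = "cube_norm n"
  have "(1 + cos (pi * ?m s)) / real k = (1 + cos (pi * ?m t)) / real k"
    using fun_cong[OF eq, of 0] by (simp add: cube_to_sphere_nth)
  then have "cos (pi * ?m s) = cos (pi * ?m t)" using k by simp
  then have "pi * ?m s = pi * ?m t"
    by (rule cos_inj_pi[rotated 4])
      (use cube_maxnorm_nonneg[OF n] cube_maxnorm_le_1[OF n s] cube_maxnorm_le_1[OF n t] in \<open>auto simp: mult_le_cancel_left1\<close>)
  then have m: "?m s = ?m t" by simp
  have ext: "s = t" if "\<And>i. i < n \<Longrightarrow> s i = t i"
    using that s t by (metis (no_types, opaque_lifting) ext mem_cube not_le)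
  consider "?m t = 1" | "?m t = 0" | "0 < ?m t" "?m t < 1"
    using cube_maxnorm_nonneg[OF n, of t] cube_maxnorm_le_1[OF n t] by linarith
  then show ?thesis
  proof cases
    case 1
    then show ?thesis using m cube_boundary_iff[OF n s] cube_boundary_iff[OF n t] by simp
  next
    case 2
    then have "?e s = 0" "?e t = 0" using m cube_norm_eq_0_iff[OF n] by auto
    then show ?thesis using ext cube_norm_zero[of n s] cube_norm_zero[of n t] by simp
  next
    case 3
    have e: "?e s > 0" "?e t > 0"
      using 3 m cube_maxnorm_le_norm[OF n, of s] cube_maxnorm_le_norm[OF n, of t] by auto
    have sin: "sin (pi * ?m t) > 0" using 3 by (intro sin_gt_zero) auto
    \<comment> \<open>The recentred points are positively proportional with factor \<open>a\<close>;
      comparing their equal, nonzero sup norms in both directions forces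
      \<open>a = 1\<close>.\<close>
    define a where "a = ?e s / ?e t"
    have a: "a > 0" using e by (simp add: a_def)
    have scal: "2 * s i - 1 = a * (2 * t i - 1)" if "i < n" for i
    proof -
      have "sin (pi * ?m t) * (2 * s i - 1) / (real k * ?e s) = sin (pi * ?m t) * (2 * t i - 1) / (real k * ?e t)"
        using fun_cong[OF eq, of "Suc i"] that m by (simp add: cube_to_sphere_nth)
      then have "sin (pi * ?m t) / real k * ((2 * s i - 1) / ?e s) = sin (pi * ?m t) / real k * ((2 * t i - 1) / ?e t)"
        by simp
      then have "(2 * s i - 1) / ?e s = (2 * t i - 1) / ?e t"
        using sin k by (subst (asm) mult_left_cancel) auto
      then show ?thesis using e by (simp add: a_def field_simps)
    qed
    obtain i where i: "i < n" "?m s = \<bar>2 * s i - 1\<bar>" using cube_maxnorm_attained[OF n] by blast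
    have "?m t \<le> a * ?m t"
      using i scal[OF i(1)] le_cube_maxnorm[OF i(1), of t] a m by (simp add: abs_mult)
    then have "1 \<le> a" using 3 by simp
    obtain j where j: "j < n" "?m t = \<bar>2 * t j - 1\<bar>" using cube_maxnorm_attained[OF n] by blast
    have "a * ?m t \<le> ?m t"
      using j scal[OF j(1)] le_cube_maxnorm[OF j(1), of s] a m by (simp add: abs_mult)
    then have "a \<le> 1" using 3 by simp
    with \<open>1 \<le> a\<close> have "a = 1" by simp
    then show ?thesis using scal ext by simp
  qed
qed

text \<open>The sphere has radius \<open>1 / k\<close> and passes through the origin. The bound by
  the diameter is uniform in the coordinate \<open>i\<close>, as coordinatewise convergence of
  shrinking spheres requires.\<close>

lemma hsphere_bounds:
  assumes "y \<in> hsphere n k" "k \<ge> 1"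
  shows "0 \<le> y 0" "y 0 \<le> 2 / real k" "\<bar>y i\<bar> \<le> 2 / real k"
proof -
  have eq: "(y 0 - 1 / real k)\<^sup>2 + (\<Sum>i\<in>{1..n}. (y i)\<^sup>2) = (1 / real k)\<^sup>2"
    and 0: "\<And>i. i > n \<Longrightarrow> y i = 0"
    using assms by (auto simp: hsphere_def)
  have "(y 0 - 1 / real k)\<^sup>2 \<le> (1 / real k)\<^sup>2"
    using eq sum_nonneg[of "{1..n}" "\<lambda>i. (y i)\<^sup>2"] by simp
  then have "\<bar>y 0 - 1 / real k\<bar> \<le> \<bar>1 / real k\<bar>" by (simp only: abs_le_square_iff)
  then have d: "\<bar>y 0 - 1 / real k\<bar> \<le> 1 / real k" by simp
  then show y0: "0 \<le> y 0" "y 0 \<le> 2 / real k" by auto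
  show "\<bar>y i\<bar> \<le> 2 / real k"
  proof (cases "i \<in> {1..n}")
    case True
    then have "(y i)\<^sup>2 \<le> (\<Sum>i\<in>{1..n}. (y i)\<^sup>2)" by (intro member_le_sum) auto
    then have "(y i)\<^sup>2 \<le> (1 / real k)\<^sup>2" using eq by (smt (verit) zero_le_power2)
    then have "\<bar>y i\<bar> \<le> \<bar>1 / real k\<bar>" by (simp only: abs_le_square_iff)
    then show ?thesis using assms(2) by (simp add: divide_le_eq field_simps)
  next
    case False
    then show ?thesis using 0 y0 by (cases "i = 0") auto
  qed
qed

lemma hsphere_0_imp_base:
  assumes "y \<in> hsphere n k" "y 0 = 0"
  shows "y = hawaiian_base"
proof -
  have "(\<Sum>i\<in>{1..n}. (y i)\<^sup>2) = 0" and 0: "\<And>i. i > n \<Longrightarrow> y i = 0"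
    using assms by (auto simp: hsphere_def)
  then have "\<And>i. i \<in> {1..n} \<Longrightarrow> y i = 0" by (simp add: sum_nonneg_eq_0_iff)
  then show ?thesis
    using 0 assms(2) by (auto simp: hawaiian_base_def fun_eq_iff) (metis le_eq_less_or_eq not_less_eq_eq One_nat_def gr0I not_le)
qed

lemma base_in_hsphere: "hawaiian_base \<in> hsphere n k"
  by (simp add: hsphere_def hawaiian_base_def)

text \<open>Expanding the sphere equation gives squared norm equal to \<open>2 * y 0 / k\<close>. On
  two spheres this yields \<open>y 0 * (1/k - 1/l) = 0\<close>, and \<open>y 0 = 0\<close> occurs
  only at the point of tangency.\<close>

lemma hsphere_unique:
  assumes "y \<in> hsphere n k" "y \<in> hsphere n l" "k \<ge> 1" "l \<ge> 1" "y \<noteq> hawaiian_base"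
  shows "k = l"
proof -
  have "(y 0 - 1 / real k)\<^sup>2 - (1 / real k)\<^sup>2 = (y 0 - 1 / real l)\<^sup>2 - (1 / real l)\<^sup>2"
    using assms(1,2) unfolding hsphere_def by simp
  then have "y 0 * (1 / real k - 1 / real l) = 0"
    by (auto simp: power2_eq_square algebra_simps)
  then have "1 / real k = 1 / real l"
    using hsphere_0_imp_base[OF assms(1)] assms(5) by (metis mult_eq_0_iff right_minus_eq)
  then show ?thesis by simp
qed

text \<open>An explicit preimage: the arccosine of the height gives the sup norm \<open>m\<close>,
  and the remaining coordinates, rescaled to sup norm \<open>m\<close>, give the recentred
  point.\<close>

lemma cube_to_sphere_surj:
  assumes n: "n \<ge> 1" and k: "k \<ge> 1" and y: "y \<in> hsphere n k"
  shows "\<exists>t\<in>topspace (cube n). cube_to_sphere n k t = y"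
proof -
  have eq: "(y 0 - 1 / real k)\<^sup>2 + (\<Sum>i\<in>{1..n}. (y i)\<^sup>2) = (1 / real k)\<^sup>2"
    and 0: "\<And>i. i > n \<Longrightarrow> y i = 0"
    using y by (auto simp: hsphere_def)
  define x where "x = real k * y 0 - 1"
  have x: "-1 \<le> x" "x \<le> 1"
    using hsphere_bounds(1,2)[OF y k] k by (auto simp: x_def field_simps)
  define m where "m = arccos x / pi"
  have m: "0 \<le> m" "m \<le> 1" "cos (pi * m) = x"
    using arccos_bounded[OF x] x by (auto simp: m_def divide_le_eq_1)
  have y0: "y 0 = (1 + cos (pi * m)) / real k"
    using k by (simp add: m x_def)
  have sin: "0 \<le> sin (pi * m)" using m by (intro sin_ge_zero) (auto simp: mult_le_cancel_left1)
  let ?v = "\<lambda>i. y (Suc i)"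
  have S: "(\<Sum>i<n. (?v i)\<^sup>2) = (sin (pi * m) / real k)\<^sup>2"
  proof -
    have "(\<Sum>i<n. (?v i)\<^sup>2) = (\<Sum>i\<in>{1..n}. (y i)\<^sup>2)"
      by (rule sum.reindex_bij_witness[of _ "\<lambda>i. i - 1" Suc]) auto
    also have "\<dots> = (1 / real k)\<^sup>2 - (y 0 - 1 / real k)\<^sup>2" using eq by simp
    also have "\<dots> = (1 - (cos (pi * m))\<^sup>2) / (real k)\<^sup>2"
      by (simp add: y0 add_divide_distrib power_divide diff_divide_distrib)
    also have "\<dots> = (sin (pi * m) / real k)\<^sup>2" by (simp add: sin_squared_eq power_divide)
    finally show ?thesis .
  qed
  define M where "M = Max ((\<lambda>i. \<bar>?v i\<bar>) ` {..<n})"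
  have Mge: "\<bar>?v i\<bar> \<le> M" if "i < n" for i
    unfolding M_def using that by (intro Max_ge) auto
  have "M \<in> (\<lambda>i. \<bar>?v i\<bar>) ` {..<n}"
    unfolding M_def using n by (intro Max_in) (auto simp: lessThan_empty_iff)
  then obtain i0 where i0: "i0 < n" "M = \<bar>?v i0\<bar>" by auto
  \<comment> \<open>\<open>M = 0\<close> means that \<open>y\<close> is one of the two poles on the
    axis. No direction is available then, and the point with all recentred coordinates equal to
    \<open>m\<close> is used.\<close>
  define c where "c i = (if M = 0 then m else m * ?v i / M)" for i
  define t where "t i = (if i < n then (1 + c i) / 2 else 0)" for i
  have c: "2 * t i - 1 = c i" if "i < n" for i using that by (simp add: t_def field_simps)
  have cle: "\<bar>c i\<bar> \<le> m" if "i < n" for i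
  proof (cases "M = 0")
    case True
    then show ?thesis using m by (simp add: c_def)
  next
    case False
    then have "M > 0" using i0 by simp
    then have "m * \<bar>?v i\<bar> \<le> m * M" using Mge[OF that] m by (intro mult_left_mono) auto
    then show ?thesis using \<open>M > 0\<close> m by (simp add: c_def abs_mult divide_le_eq)
  qed
  have t: "t \<in> topspace (cube n)"
    using cle m by (force simp: mem_cube t_def abs_le_iff)
  have c0: "\<bar>c i0\<bar> = m"
    using i0 m by (auto simp: c_def abs_mult)
  have mt: "cube_maxnorm n t = m"
  proof (rule antisym)
    obtain i where "i < n" "cube_maxnorm n t = \<bar>2 * t i - 1\<bar>"
      using cube_maxnorm_attained[OF n] by blast
    then show "cube_maxnorm n t \<le> m" using cle c by auto
    show "m \<le> cube_maxnorm n t" using le_cube_maxnorm[OF i0(1), of t] c0 c i0 by simp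
  qed
  have comp: "sin (pi * m) * c i / (real k * cube_norm n t) = ?v i" if i: "i < n" for i
  proof (cases "M = 0")
    case True
    then have "?v i = 0" "(\<Sum>i<n. (?v i)\<^sup>2) = 0" using Mge i by auto
    then show ?thesis using S k by simp
  next
    case False
    then have M: "M > 0" using i0 by simp
    have "0 < (?v i0)\<^sup>2" using i0 False by simp
    also have "\<dots> \<le> (\<Sum>i<n. (?v i)\<^sup>2)" using i0 by (intro member_le_sum) auto
    finally have sp: "sin (pi * m) > 0" using S sin by (cases "sin (pi * m) = 0") auto
    then have "m \<noteq> 0" by auto
    \<comment> \<open>Rescaling by \<open>m / M\<close> multiplies the Euclidean length of the tail
      of \<open>y\<close>, which is \<open>sin (pi * m) / k\<close>, by the same factor; the factors
      then cancel in the image.\<close>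
    have "(cube_norm n t)\<^sup>2 = (\<Sum>i<n. (m / M)\<^sup>2 * (?v i)\<^sup>2)"
      using c False by (simp add: cube_norm_sq c_def power_divide power_mult_distrib)
    also have "\<dots> = (m / M * (sin (pi * m) / real k))\<^sup>2"
      unfolding sum_distrib_left[symmetric] S by (simp only: power_mult_distrib)
    finally have "cube_norm n t = m / M * (sin (pi * m) / real k)"
      using M m sin by (subst (asm) power2_eq_iff_nonneg) (auto simp: cube_norm_def sum_nonneg)
    then show ?thesis using M sp \<open>m \<noteq> 0\<close> k False by (simp add: c_def)
  qed
  have "cube_to_sphere n k t = y"
  proof
    fix j
    show "cube_to_sphere n k t j = y j"
      using comp[of "j - 1"] c[of "j - 1"] 0[of j] y0 mt by (auto simp: cube_to_sphere_nth)
  qed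
  with t show ?thesis by blast
qed

text \<open>Tychonoff, with the singleton {0} in every coordinate from \<open>n\<close> on.
  Compactness makes the maps onto the spheres closed.\<close>

lemma compact_space_cube: "compact_space (cube n)"
proof -
  have eq: "topspace (cube n) = PiE UNIV (\<lambda>i. if i < n then {0..1} else {0})"
    by (auto simp: mem_cube PiE_iff split: if_splits) (metis not_le)
  have "compactin (product_topology (\<lambda>i. euclideanreal) UNIV) (PiE UNIV (\<lambda>i. if i < n then {0..1} else {0}))"
    by (subst compactin_PiE) auto
  then show ?thesis
    by (subst cube_eq_top_of_set) (simp add: eq euclidean_product_topology compact_space_subtopology)
qed

section \<open>The earring as a union of images of cubes\<close>

lemma mem_hawaiian_earring:
  "y \<in> topspace (hawaiian_earring n) \<longleftrightarrow> (\<exists>k\<ge>1. y \<in> hsphere n k)"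
  by (auto simp: hawaiian_earring_def Euclidean_space_def hsphere_def)

lemma hawaiian_earring_eq_top_of_set:
  "hawaiian_earring n = top_of_set (topspace (hawaiian_earring n))"
  by (simp add: hawaiian_earring_def Euclidean_space_def euclidean_product_topology subtopology_subtopology)

lemma Hausdorff_space_hawaiian_earring: "Hausdorff_space (hawaiian_earring n)"
  by (subst hawaiian_earring_eq_top_of_set) (simp add: Hausdorff_space_subtopology)

lemma base_in_hawaiian_earring: "hawaiian_base \<in> topspace (hawaiian_earring n)"
  using base_in_hsphere[of n 1] by (auto simp: mem_hawaiian_earring)

lemma cube_to_sphere_in_earring:
  "n \<ge> 1 \<Longrightarrow> k \<ge> 1 \<Longrightarrow> cube_to_sphere n k t \<in> topspace (hawaiian_earring n)"
  using cube_to_sphere_in_hsphere by (auto simp: mem_hawaiian_earring)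

lemma mem_hawaiian_earring_cube:
  "n \<ge> 1 \<Longrightarrow> y \<in> topspace (hawaiian_earring n) \<longleftrightarrow>
     (\<exists>k\<ge>1. \<exists>t\<in>topspace (cube n). y = cube_to_sphere n k t)"
  using cube_to_sphere_surj cube_to_sphere_in_earring unfolding mem_hawaiian_earring by metis

lemma continuous_map_cube_to_sphere:
  assumes "n \<ge> 1" "k \<ge> 1"
  shows "continuous_map (cube n) (hawaiian_earring n) (cube_to_sphere n k)"
proof -
  have "continuous_map (top_of_set (topspace (cube n))) (top_of_set (topspace (hawaiian_earring n))) (cube_to_sphere n k)"
    using cube_to_sphere_in_earring[OF assms] continuous_on_subset[OF continuous_on_cube_to_sphere[OF assms(1)]]
    by (auto simp: continuous_map_in_subtopology)
  then show ?thesis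
    by (simp flip: cube_eq_top_of_set hawaiian_earring_eq_top_of_set)
qed

lemma zero_in_cube_boundary: "n \<ge> 1 \<Longrightarrow> (\<lambda>i. 0) \<in> cube_boundary n"
  by (auto simp: cube_boundary_def mem_cube intro!: exI[of _ 0])

text \<open>The zero point lies on the boundary and maps to the base point, so injectivity off the
  boundary pushes every other preimage into the boundary too.\<close>

lemma cube_to_sphere_eq_base_iff:
  assumes "n \<ge> 1" "k \<ge> 1" "t \<in> topspace (cube n)"
  shows "cube_to_sphere n k t = hawaiian_base \<longleftrightarrow> t \<in> cube_boundary n"
proof
  assume "cube_to_sphere n k t = hawaiian_base"
  then have "cube_to_sphere n k t = cube_to_sphere n k (\<lambda>i. 0)"
    using cube_to_sphere_boundary[OF assms(1) zero_in_cube_boundary[OF assms(1)]] by simp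
  then show "t \<in> cube_boundary n"
    using cube_to_sphere_inj[OF assms cube_boundary_subset[OF zero_in_cube_boundary[OF assms(1)]]]
      zero_in_cube_boundary[OF assms(1)] by auto
qed (rule cube_to_sphere_boundary[OF assms(1)])

section \<open>Gluing maps along the spheres\<close>

text \<open>The choice pattern copies that of \<open>hawaiian_concat\<close>, which thereby becomes
  an instance by mere unfolding. The choices are harmless once all \<open>p k\<close> send the cube
  boundary to one common point.\<close>

definition sphere_glue :: "nat \<Rightarrow> (nat \<Rightarrow> (nat \<Rightarrow> real) \<Rightarrow> 'a) \<Rightarrow> (nat \<Rightarrow> real) \<Rightarrow> 'a" where
  "sphere_glue n p y =
     (let k = (SOME k. k \<ge> 1 \<and> y \<in> hsphere n k)
      in p k (SOME t. t \<in> topspace (cube n) \<and> cube_to_sphere n k t = y))"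

lemma hawaiian_concat_eq_glue:
  "hawaiian_concat n f g =
     sphere_glue n (\<lambda>k. cube_concat (f \<circ> cube_to_sphere n k) (g \<circ> cube_to_sphere n k))"
  by (simp add: fun_eq_iff hawaiian_concat_def sphere_glue_def)

text \<open>The sphere index is ambiguous only at the base point and the preimage only on the cube
  boundary; in both cases every candidate value is \<open>x0\<close>.\<close>

lemma sphere_glue_cube_to_sphere:
  assumes n: "n \<ge> 1" and k: "k \<ge> 1" and t: "t \<in> topspace (cube n)"
    and p: "\<And>l u. l \<ge> 1 \<Longrightarrow> u \<in> cube_boundary n \<Longrightarrow> p l u = x0"
  shows "sphere_glue n p (cube_to_sphere n k t) = p k t"
proof -
  let ?y = "cube_to_sphere n k t"
  define l where "l = (SOME k. k \<ge> 1 \<and> ?y \<in> hsphere n k)"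
  have l: "l \<ge> 1 \<and> ?y \<in> hsphere n l"
    unfolding l_def by (rule someI_ex) (use k cube_to_sphere_in_hsphere[OF n] in auto)
  define u where "u = (SOME t. t \<in> topspace (cube n) \<and> cube_to_sphere n l t = ?y)"
  have u: "u \<in> topspace (cube n) \<and> cube_to_sphere n l u = ?y"
    unfolding u_def
    by (rule someI_ex[where P = "\<lambda>t. t \<in> topspace (cube n) \<and> cube_to_sphere n l t = ?y"])
      (use cube_to_sphere_surj[OF n, of l ?y] l in blast)
  have "p l u = p k t"
  proof (cases "?y = hawaiian_base")
    case True
    then have "t \<in> cube_boundary n" "u \<in> cube_boundary n"
      using cube_to_sphere_eq_base_iff n k t u l by metis+
    then show ?thesis using p l k by simp
  next
    case False
    then have "l = k"
      using hsphere_unique[of ?y n l k] l k cube_to_sphere_in_hsphere[OF n] by auto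
    then show ?thesis
      using cube_to_sphere_inj[OF n k _ t, of u] u p k by auto
  qed
  then show ?thesis unfolding sphere_glue_def Let_def l_def[symmetric] u_def[symmetric] .
qed

text \<open>Continuity at the base point is the only delicate issue: there the preimage of a closed set is
  written as the intersection over \<open>K\<close> of a finite union of compact pieces with
  the slab \<open>y 0 \<le> 2 / K\<close>, which contains all spheres of index at least \<open>K\<close>.\<close>

lemma continuous_map_sphere_glue:
  assumes n: "n \<ge> 1" and T: "compact_space T" "Hausdorff_space T"
    and q: "\<And>k. k \<ge> 1 \<Longrightarrow> continuous_map (prod_topology T (cube n)) X (q k)"
    and bd: "\<And>k s u. k \<ge> 1 \<Longrightarrow> s \<in> topspace T \<Longrightarrow> u \<in> cube_boundary n \<Longrightarrow> q k (s, u) = x0"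
    and small: "\<And>W. openin X W \<Longrightarrow> x0 \<in> W \<Longrightarrow>
      \<exists>K. \<forall>k\<ge>K. \<forall>s\<in>topspace T. \<forall>u\<in>topspace (cube n). q k (s, u) \<in> W"
  shows "continuous_map (prod_topology T (hawaiian_earring n)) X
           (\<lambda>z. sphere_glue n (\<lambda>k u. q k (fst z, u)) (snd z))"
proof -
  let ?P = "prod_topology T (hawaiian_earring n)" and ?Q = "prod_topology T (cube n)"
  let ?H = "\<lambda>z. sphere_glue n (\<lambda>k u. q k (fst z, u)) (snd z)"
  let ?\<pi> = "\<lambda>k z. (fst z, cube_to_sphere n k (snd z))"
  have H: "?H (s, cube_to_sphere n k u) = q k (s, u)"
    if "k \<ge> 1" "s \<in> topspace T" "u \<in> topspace (cube n)" for k s u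
    using sphere_glue_cube_to_sphere[OF n that(1,3), of "\<lambda>k u. q k (s, u)" x0] bd that by simp
  have top: "\<exists>k s u. k \<ge> 1 \<and> s \<in> topspace T \<and> u \<in> topspace (cube n) \<and> z = (s, cube_to_sphere n k u)"
    if "z \<in> topspace ?P" for z
    using that n by (cases z) (auto simp: mem_hawaiian_earring_cube)
  have cpi: "continuous_map ?Q ?P (?\<pi> k)" if "k \<ge> 1" for k
    using continuous_map_compose[OF continuous_map_snd continuous_map_cube_to_sphere[OF n that]]
    by (simp add: continuous_map_pairwise o_def continuous_map_fst)
  \<comment> \<open>A continuous map from a compact space to a Hausdorff space is closed; this is
    the use of both assumptions on \<open>T\<close>.\<close>
  have clpi: "closed_map ?Q ?P (?\<pi> k)" if "k \<ge> 1" for k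
    using T by (intro continuous_imp_closed_map cpi that)
      (simp_all add: compact_space_prod_topology compact_space_cube Hausdorff_space_prod_topology
        Hausdorff_space_hawaiian_earring)
  show ?thesis
    unfolding continuous_map_closedin
  proof (intro conjI allI impI)
    show "?H \<in> topspace ?P \<rightarrow> topspace X"
    proof
      fix z assume "z \<in> topspace ?P"
      then obtain k s u where z: "k \<ge> 1" "s \<in> topspace T" "u \<in> topspace (cube n)" "z = (s, cube_to_sphere n k u)"
        using top by blast
      then have "q k (s, u) \<in> topspace X"
        using continuous_map_image_subset_topspace[OF q[OF z(1)]] by auto
      then show "?H z \<in> topspace X" using H[OF z(1-3)] z(4) by simp
    qed
    fix C assume C: "closedin X C"
    \<comment> \<open>The part of the preimage of \<open>C\<close> over the k-th sphere, closed
      because it is the image of a closed set under a closed map.\<close>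
    define D where "D k = ?\<pi> k ` {z \<in> topspace ?Q. q k z \<in> C}" for k
    have D: "closedin ?P (D k)" if "k \<ge> 1" for k
      using clpi[OF that] closedin_continuous_map_preimage[OF q[OF that] C]
      unfolding D_def closed_map_def by blast
    have mem: "z \<in> topspace ?P \<and> ?H z \<in> C \<longleftrightarrow> (\<exists>k\<ge>1. z \<in> D k)" for z
    proof
      assume z: "z \<in> topspace ?P \<and> ?H z \<in> C"
      then obtain k s u where z': "k \<ge> 1" "s \<in> topspace T" "u \<in> topspace (cube n)" "z = (s, cube_to_sphere n k u)"
        using top by blast
      then have "q k (s, u) \<in> C" using H[OF z'(1-3)] z by simp
      then have "(s, u) \<in> {z \<in> topspace ?Q. q k z \<in> C}" using z' by simp
      then have "?\<pi> k (s, u) \<in> D k" unfolding D_def by (rule imageI)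
      then show "\<exists>k\<ge>1. z \<in> D k" using z' by auto
    next
      assume "\<exists>k\<ge>1. z \<in> D k"
      then obtain k s u where "k \<ge> 1" "s \<in> topspace T" "u \<in> topspace (cube n)" "z = (s, cube_to_sphere n k u)"
          "q k (s, u) \<in> C"
        unfolding D_def by auto
      then show "z \<in> topspace ?P \<and> ?H z \<in> C"
        using H cube_to_sphere_in_earring[OF n] by auto
    qed
    show "closedin ?P {z \<in> topspace ?P. ?H z \<in> C}"
    proof (cases "x0 \<in> C")
      case False
      \<comment> \<open>\<open>x0\<close> is attained by \<open>q 1\<close> on the cube boundary as
        soon as \<open>T\<close> has a point.\<close>
      have "x0 \<in> topspace X" if ne: "topspace T \<noteq> {}"
      proof -
        obtain s where "s \<in> topspace T" using ne by blast
        moreover from this have "q 1 (s, \<lambda>i. 0) \<in> topspace X"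
          using continuous_map_funspace[OF q[of 1]] cube_boundary_subset[OF zero_in_cube_boundary[OF n]] by auto
        ultimately show ?thesis
          using bd[of 1 s "\<lambda>i. 0"] zero_in_cube_boundary[OF n] by simp
      qed
      then consider "topspace T = {}" | "x0 \<in> topspace X - C" using False by blast
      then show ?thesis
      proof cases
        case 1
        then show ?thesis by simp
      next
        case 2
        \<comment> \<open>The complement of \<open>C\<close> is a neighbourhood of
          \<open>x0\<close>, so all but finitely many pieces \<open>D k\<close> are empty and the
          union is finite.\<close>
        then obtain K where K: "\<And>k s u. k \<ge> K \<Longrightarrow> s \<in> topspace T \<Longrightarrow> u \<in> topspace (cube n) \<Longrightarrow> q k (s, u) \<in> topspace X - C"
          using small[of "topspace X - C"] C by (meson openin_diff openin_topspace)
        have empty: "D k = {}" if "k \<ge> K" for k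
          using K[OF that] unfolding D_def by auto
        have "{z \<in> topspace ?P. ?H z \<in> C} = (\<Union>k\<in>{1..<K}. D k)"
        proof (rule Set.set_eqI)
          fix z
          have "(\<exists>k\<ge>1. z \<in> D k) \<longleftrightarrow> (\<exists>k\<in>{1..<K}. z \<in> D k)"
            using empty by (metis atLeastLessThan_iff empty_iff not_le)
          then show "z \<in> {z \<in> topspace ?P. ?H z \<in> C} \<longleftrightarrow> z \<in> (\<Union>k\<in>{1..<K}. D k)"
            using mem[of z] by simp
        qed
        moreover have "closedin ?P (\<Union>k\<in>{1..<K}. D k)"
          using D by (intro closedin_Union) auto
        ultimately show ?thesis by simp
      qed
    next
      case True
      have snd0: "continuous_map ?P euclideanreal (\<lambda>z. snd z 0)"
      proof -
        have "continuous_map (top_of_set (topspace (hawaiian_earring n))) euclideanreal (\<lambda>y. y 0)"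
          using continuous_on_coord by simp
        then have "continuous_map (hawaiian_earring n) euclideanreal (\<lambda>y. y 0)"
          by (simp flip: hawaiian_earring_eq_top_of_set)
        from continuous_map_compose[OF continuous_map_snd this] show ?thesis by (simp add: o_def)
      qed
      define E where "E K = (\<Union>k\<in>{1..<K}. D k) \<union> {z \<in> topspace ?P. snd z 0 \<in> {..2 / real K}}" for K
      have E: "closedin ?P (E K)" for K
        unfolding E_def
      proof (rule closedin_Un)
        show "closedin ?P (\<Union>k\<in>{1..<K}. D k)"
          using D by (intro closedin_Union) auto
        show "closedin ?P {z \<in> topspace ?P. snd z 0 \<in> {..2 / real K}}"
          by (rule closedin_continuous_map_preimage[OF snd0]) simp
      qed
      have "{z \<in> topspace ?P. ?H z \<in> C} = (\<Inter>K\<in>{1..}. E K)"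
      proof (intro equalityI subsetI)
        fix z assume "z \<in> {z \<in> topspace ?P. ?H z \<in> C}"
        then obtain k where z: "z \<in> topspace ?P" "k \<ge> 1" "z \<in> D k" using mem by blast
        show "z \<in> (\<Inter>K\<in>{1..}. E K)"
        proof
          fix K :: nat assume K: "K \<in> {1..}"
          show "z \<in> E K"
          proof (cases "k < K")
            case True
            then show ?thesis using z by (auto simp: E_def)
          next
            case False
            obtain u where "snd z = cube_to_sphere n k u" using z(3) unfolding D_def by auto
            then have "snd z 0 \<le> 2 / real k"
              using hsphere_bounds(2)[OF cube_to_sphere_in_hsphere[OF n] z(2)] by simp
            also have "\<dots> \<le> 2 / real K" using False K by (intro divide_left_mono) auto
            finally show ?thesis using z by (simp add: E_def)
          qed
        qed
      next
        fix z assume z: "z \<in> (\<Inter>K\<in>{1..}. E K)"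
        then have "z \<in> E 1" by blast
        then have zP: "z \<in> topspace ?P" by (simp add: E_def)
        then obtain k where k: "k \<ge> 1" "snd z \<in> hsphere n k"
          by (auto simp: mem_hawaiian_earring)
        show "z \<in> {z \<in> topspace ?P. ?H z \<in> C}"
        proof (cases "snd z = hawaiian_base")
          case base: True
          have s: "fst z \<in> topspace T" using zP by auto
          have "snd z = cube_to_sphere n 1 (\<lambda>i. 0)"
            using base cube_to_sphere_boundary[OF n zero_in_cube_boundary[OF n]] by simp
          then have "?H z = x0"
            using H[OF _ s cube_boundary_subset[OF zero_in_cube_boundary[OF n]], of 1]
              bd[OF _ s zero_in_cube_boundary[OF n], of 1] by simp
          then show ?thesis using zP True by simp
        next
          case False
          then have "snd z 0 > 0"
            using hsphere_bounds(1)[OF k(2,1)] hsphere_0_imp_base[OF k(2)] by (metis less_eq_real_def)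
          \<comment> \<open>Off the base point \<open>y 0\<close> is positive, so a thin enough slab
            misses the point, which must then lie in one of the finitely many pieces.
            \<open>Suc K\<close> keeps the denominator positive.\<close>
          then obtain K :: nat where "2 / snd z 0 < real K" using reals_Archimedean2 by blast
          then have "2 < real K * snd z 0"
            using \<open>snd z 0 > 0\<close> by (simp only: pos_divide_less_eq)
          also have "\<dots> \<le> snd z 0 * real (Suc K)"
            using \<open>snd z 0 > 0\<close> by (simp add: algebra_simps)
          finally have K: "\<not> snd z 0 \<le> 2 / real (Suc K)"
            by (simp only: pos_divide_less_eq of_nat_0_less_iff zero_less_Suc not_le)
          have "z \<in> E (Suc K)" using INT_D[OF z, of "Suc K"] by simp
          then have "z \<in> (\<Union>k\<in>{1..<Suc K}. D k)" using K unfolding E_def by blast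
          then have "\<exists>k\<ge>1. z \<in> D k" by auto
          then show ?thesis using mem by blast
        qed
      qed
      moreover have "closedin ?P (\<Inter>K\<in>{1..}. E K)"
        using E by (intro closedin_Inter) auto
      ultimately show ?thesis by simp
    qed
  qed
qed

corollary continuous_map_sphere_glue_single:
  assumes n: "n \<ge> 1"
    and p: "\<And>k. k \<ge> 1 \<Longrightarrow> p k \<in> cube_maps n X x0"
    and small: "\<And>W. openin X W \<Longrightarrow> x0 \<in> W \<Longrightarrow> \<exists>K. \<forall>k\<ge>K. \<forall>u\<in>topspace (cube n). p k u \<in> W"
  shows "continuous_map (hawaiian_earring n) X (sphere_glue n p)"
proof -
  \<comment> \<open>A one-point parameter space turns the statement on homotopies into one on
    maps.\<close>
  let ?T = "top_of_set {0::real}"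
  have "continuous_map (prod_topology ?T (hawaiian_earring n)) X
          (\<lambda>z. sphere_glue n (\<lambda>k u. (p k \<circ> snd) (fst z, u)) (snd z))"
  proof (rule continuous_map_sphere_glue[OF n])
    show "compact_space ?T" by (simp add: compact_space_subtopology)
    show "Hausdorff_space ?T" by (simp add: Hausdorff_space_subtopology)
    fix k :: nat assume "k \<ge> 1"
    then show "continuous_map (prod_topology ?T (cube n)) X (p k \<circ> snd)"
      using continuous_map_compose[OF continuous_map_snd cube_mapsD(1)[OF p]] by blast
    show "(p k \<circ> snd) (s, u) = x0" if "u \<in> cube_boundary n" for s :: real and u
      using cube_mapsD(2)[OF p[OF \<open>k \<ge> 1\<close>] that] by simp
  next
    fix W assume "openin X W" "x0 \<in> W"
    then show "\<exists>K. \<forall>k\<ge>K. \<forall>s\<in>topspace ?T. \<forall>u\<in>topspace (cube n). (p k \<circ> snd) (s, u) \<in> W"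
      using small by simp
  qed
  from continuous_map_o_Pair[OF this, of 0] show ?thesis by (simp add: o_def)
qed

text \<open>From every sphere that leaves the preimage neighbourhood \<open>V\<close> a point
  outside \<open>V\<close> is picked, otherwise the base point. The diameters tend to 0, so this
  sequence converges to the base point and ends up in \<open>V\<close>; hence eventually no sphere
  leaves it.\<close>

lemma hawaiian_spheres_shrink:
  assumes f: "continuous_map (hawaiian_earring n) X f" and W: "openin X W" "f hawaiian_base \<in> W"
  shows "\<exists>K\<ge>1. \<forall>k\<ge>K. \<forall>y\<in>hsphere n k. f y \<in> W"
proof -
  have "openin (hawaiian_earring n) {y \<in> topspace (hawaiian_earring n). f y \<in> W}"
    by (rule openin_continuous_map_preimage[OF f W(1)])
  then have "openin (top_of_set (topspace (hawaiian_earring n))) {y \<in> topspace (hawaiian_earring n). f y \<in> W}"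
    by (simp flip: hawaiian_earring_eq_top_of_set)
  then obtain V where V: "open V" "{y \<in> topspace (hawaiian_earring n). f y \<in> W} = topspace (hawaiian_earring n) \<inter> V"
    by (auto simp: openin_open)
  then have base: "hawaiian_base \<in> V" using W(2) base_in_hawaiian_earring by blast
  define y where "y k = (if \<exists>y\<in>hsphere n k. y \<notin> V then SOME y. y \<in> hsphere n k \<and> y \<notin> V else hawaiian_base)" for k
  have y: "(y k \<in> hsphere n k) \<and> ((\<exists>y\<in>hsphere n k. y \<notin> V) \<longrightarrow> y k \<notin> V)" for k
  proof (cases "\<exists>y\<in>hsphere n k. y \<notin> V")
    case True
    then have "\<exists>y. y \<in> hsphere n k \<and> y \<notin> V" by blast
    from someI_ex[OF this] show ?thesis using True by (simp add: y_def)
  qed (simp add: y_def base_in_hsphere)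
  have lim: "(\<lambda>k. y k i) \<longlonglongrightarrow> 0" for i
  proof (rule tendsto_0_le[where K = 2])
    show "(\<lambda>k. 1 / real k) \<longlonglongrightarrow> 0" by (rule lim_1_over_n)
    show "\<forall>\<^sub>F k in sequentially. norm (y k i) \<le> norm (1 / real k) * 2"
      using eventually_ge_at_top[of 1] by eventually_elim (use hsphere_bounds(3) y in force)
  qed
  have "limitin (product_topology (\<lambda>i. euclideanreal) UNIV) y hawaiian_base sequentially"
    using lim by (simp add: limitin_componentwise hawaiian_base_def)
  then have "y \<longlonglongrightarrow> hawaiian_base" by (simp add: euclidean_product_topology)
  then have "\<forall>\<^sub>F k in sequentially. y k \<in> V" using V(1) base by (rule topological_tendstoD)
  then obtain K where K: "\<And>k. k \<ge> K \<Longrightarrow> y k \<in> V" by (auto simp: eventually_sequentially)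
  have "f z \<in> W" if k: "k \<ge> max 1 K" and z: "z \<in> hsphere n k" for k z
  proof -
    have "z \<in> V" using y[of k] K[of k] k z by auto
    moreover have "z \<in> topspace (hawaiian_earring n)" using k z by (auto simp: mem_hawaiian_earring)
    ultimately show ?thesis using V(2) by blast
  qed
  then show ?thesis by (metis max.cobounded1)
qed

section \<open>The Hawaiian group\<close>

lemma hawaiian_mapsD:
  assumes "f \<in> hawaiian_maps n X x0"
  shows "continuous_map (hawaiian_earring n) X f" "f hawaiian_base = x0"
  using assms by (auto simp: hawaiian_maps_def)

lemma hawaiian_homotopic_iff:
  "hawaiian_homotopic n X x0 f g \<longleftrightarrow>
     (\<exists>h. continuous_map (prod_topology (top_of_set {0..1::real}) (hawaiian_earring n)) X h \<and>
          (\<forall>y\<in>topspace (hawaiian_earring n). h (0, y) = f y) \<and>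
          (\<forall>y\<in>topspace (hawaiian_earring n). h (1, y) = g y) \<and>
          (\<forall>s\<in>{0..1}. h (s, hawaiian_base) = x0))"
  unfolding hawaiian_homotopic_def
  by (subst homotopic_with) (auto simp: base_in_hawaiian_earring)

lemma hawaiian_homotopic_equal:
  assumes "f \<in> hawaiian_maps n X x0" "\<And>y. y \<in> topspace (hawaiian_earring n) \<Longrightarrow> f y = g y"
  shows "hawaiian_homotopic n X x0 f g"
  unfolding hawaiian_homotopic_def
proof (rule homotopic_with_equal)
  show "f hawaiian_base = x0" "g hawaiian_base = x0"
    using hawaiian_mapsD(2)[OF assms(1)] assms(2)[OF base_in_hawaiian_earring] by simp_all
qed (use hawaiian_mapsD(1)[OF assms(1)] assms(2) in auto)

lemma hawaiian_homotopic_sym: "hawaiian_homotopic n X x0 f g \<longleftrightarrow> hawaiian_homotopic n X x0 g f"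
  unfolding hawaiian_homotopic_def by (rule homotopic_with_sym)

lemma hawaiian_homotopic_trans:
  "hawaiian_homotopic n X x0 f g \<Longrightarrow> hawaiian_homotopic n X x0 g h \<Longrightarrow> hawaiian_homotopic n X x0 f h"
  unfolding hawaiian_homotopic_def by (rule homotopic_with_trans)

lemma hawaiian_class_self: "f \<in> hawaiian_maps n X x0 \<Longrightarrow> f \<in> hawaiian_class n X x0 f"
  by (simp add: hawaiian_class_def hawaiian_homotopic_equal)

lemma hawaiian_class_eqI:
  assumes fg: "hawaiian_homotopic n X x0 f g"
  shows "hawaiian_class n X x0 f = hawaiian_class n X x0 g"
proof -
  have "hawaiian_homotopic n X x0 f h \<longleftrightarrow> hawaiian_homotopic n X x0 g h" for h
    using fg hawaiian_homotopic_trans[of n X x0 f g h] hawaiian_homotopic_trans[of n X x0 g f h]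
      hawaiian_homotopic_sym[of n X x0 f g] by metis
  then show ?thesis by (simp add: hawaiian_class_def)
qed

lemma hawaiian_map_on_sphere:
  assumes "f \<in> hawaiian_maps n X x0" "n \<ge> 1" "k \<ge> 1"
  shows "f \<circ> cube_to_sphere n k \<in> cube_maps n X x0"
  using continuous_map_compose[OF continuous_map_cube_to_sphere[OF assms(2,3)] hawaiian_mapsD(1)[OF assms(1)]]
    cube_to_sphere_boundary[OF assms(2)] hawaiian_mapsD(2)[OF assms(1)]
  by (simp add: cube_maps_def image_subset_iff)

lemma sphere_glue_base:
  assumes "n \<ge> 1" "\<And>l u. l \<ge> 1 \<Longrightarrow> u \<in> cube_boundary n \<Longrightarrow> p l u = x0"
  shows "sphere_glue n p hawaiian_base = x0"
proof -
  note z = zero_in_cube_boundary[OF assms(1)]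
  have "sphere_glue n p (cube_to_sphere n 1 (\<lambda>i. 0)) = p 1 (\<lambda>i. 0)"
    by (rule sphere_glue_cube_to_sphere[OF assms(1) _ cube_boundary_subset[OF z]]) (use assms(2) in auto)
  then show ?thesis
    using assms(2)[OF _ z, of 1] cube_to_sphere_boundary[OF assms(1) z] by simp
qed

lemma sphere_glue_in_hawaiian_maps:
  assumes n: "n \<ge> 1" and p: "\<And>k. k \<ge> 1 \<Longrightarrow> p k \<in> cube_maps n X x0"
    and small: "\<And>W. openin X W \<Longrightarrow> x0 \<in> W \<Longrightarrow> \<exists>K. \<forall>k\<ge>K. \<forall>u\<in>topspace (cube n). p k u \<in> W"
  shows "sphere_glue n p \<in> hawaiian_maps n X x0"
  using continuous_map_sphere_glue_single[OF assms] sphere_glue_base[OF n cube_mapsD(2)[OF p]]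
  by (simp add: hawaiian_maps_def)

text \<open>On the k-th sphere a concatenation takes only values that \<open>f\<close> or
  \<open>g\<close> takes on that same sphere, so smallness near the base point is inherited.\<close>

lemma hawaiian_concat_in_maps:
  assumes f: "f \<in> hawaiian_maps n X x0" and g: "g \<in> hawaiian_maps n X x0" and n: "n \<ge> 1"
  shows "hawaiian_concat n f g \<in> hawaiian_maps n X x0"
  unfolding hawaiian_concat_eq_glue
proof (rule sphere_glue_in_hawaiian_maps[OF n])
  show "cube_concat (f \<circ> cube_to_sphere n k) (g \<circ> cube_to_sphere n k) \<in> cube_maps n X x0" if "k \<ge> 1" for k
    by (intro cube_concat_in_maps hawaiian_map_on_sphere f g n that)
  fix W assume W: "openin X W" "x0 \<in> W"
  obtain K where K: "\<And>k y. k \<ge> K \<Longrightarrow> y \<in> hsphere n k \<Longrightarrow> f y \<in> W"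
    using hawaiian_spheres_shrink[OF hawaiian_mapsD(1)[OF f] W(1)] hawaiian_mapsD(2)[OF f] W(2) by blast
  obtain L where L: "\<And>k y. k \<ge> L \<Longrightarrow> y \<in> hsphere n k \<Longrightarrow> g y \<in> W"
    using hawaiian_spheres_shrink[OF hawaiian_mapsD(1)[OF g] W(1)] hawaiian_mapsD(2)[OF g] W(2) by blast
  have "cube_concat (f \<circ> cube_to_sphere n k) (g \<circ> cube_to_sphere n k) u \<in> W" if "k \<ge> max K L" for k u
    using that K[OF _ cube_to_sphere_in_hsphere[OF n]] L[OF _ cube_to_sphere_in_hsphere[OF n]]
    by (simp add: cube_concat_def)
  then show "\<exists>K. \<forall>k\<ge>K. \<forall>u\<in>topspace (cube n).
      cube_concat (f \<circ> cube_to_sphere n k) (g \<circ> cube_to_sphere n k) u \<in> W" by blast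
qed

lemma hawaiian_concat_on_sphere:
  assumes f: "f \<in> hawaiian_maps n X x0" and g: "g \<in> hawaiian_maps n X x0" and n: "n \<ge> 1" and k: "k \<ge> 1"
    and t: "t \<in> topspace (cube n)"
  shows "hawaiian_concat n f g (cube_to_sphere n k t) =
         cube_concat (f \<circ> cube_to_sphere n k) (g \<circ> cube_to_sphere n k) t"
  unfolding hawaiian_concat_eq_glue
  using cube_mapsD(2)[OF cube_concat_in_maps[OF hawaiian_map_on_sphere[OF f n] hawaiian_map_on_sphere[OF g n] n]]
  by (intro sphere_glue_cube_to_sphere[OF n k t]) auto

section \<open>Contracting the small spheres and truncating maps\<close>

lemma semilocal_contraction:
  assumes "semilocally_strongly_contractible_at X x0"
  obtains V C where "openin X V" "x0 \<in> V"
    "continuous_map (prod_topology (top_of_set {0..1::real}) (subtopology X V)) X C"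
    "\<And>x. x \<in> V \<Longrightarrow> C (0, x) = x" "\<And>x. x \<in> V \<Longrightarrow> C (1, x) = x0"
    "\<And>s. s \<in> {0..1} \<Longrightarrow> C (s, x0) = x0"
proof -
  obtain U V where V: "openin X V" "x0 \<in> V" "V \<subseteq> U"
    and hom: "homotopic_with (\<lambda>h. h x0 = x0) (subtopology X U) X (\<lambda>x. x) (\<lambda>x. x0)"
    using assms by (auto simp: semilocally_strongly_contractible_at_def)
  obtain C where C: "continuous_map (prod_topology (top_of_set {0..1::real}) (subtopology X U)) X C"
    "\<And>x. C (0, x) = x" "\<And>x. C (1, x) = x0" "\<And>s. s \<in> {0..1} \<Longrightarrow> C (s, x0) = x0"
    using hom unfolding homotopic_with_def by blast
  \<comment> \<open>\<open>U\<close> itself need not be open. Over the open \<open>V\<close>, sets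
    open in the subspace are open in \<open>X\<close>, which the later tube argument uses.\<close>
  have "continuous_map (subtopology X V) (subtopology X U) (\<lambda>x. x)"
    using V(3) by (auto simp: continuous_map_in_subtopology continuous_map_from_subtopology)
  from continuous_map_compose[OF continuous_map_snd this]
  have "continuous_map (prod_topology (top_of_set {0..1::real}) (subtopology X V))
          (prod_topology (top_of_set {0..1}) (subtopology X U)) (\<lambda>z. (fst z, snd z))"
    by (simp add: continuous_map_pairwise o_def continuous_map_fst)
  from continuous_map_compose[OF this C(1)]
  have "continuous_map (prod_topology (top_of_set {0..1::real}) (subtopology X V)) X C"
    by (simp add: o_def)
  with V C show ?thesis by (intro that[of V C]) auto
qed

text \<open>The second conclusion holds for every \<open>L\<close> beyond \<open>K\<close>, so that
  two maps can later be cut at the same index. The first one supplies the finite support.\<close>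

lemma hawaiian_truncation:
  assumes x0: "x0 \<in> topspace X" and sc: "semilocally_strongly_contractible_at X x0" and n: "n \<ge> 1"
    and f: "f \<in> hawaiian_maps n X x0"
  obtains K where "\<And>k. k \<ge> K \<Longrightarrow> cube_homotopic n X x0 (f \<circ> cube_to_sphere n k) (\<lambda>u. x0)"
    "\<And>L. L \<ge> K \<Longrightarrow> hawaiian_homotopic n X x0 f
       (sphere_glue n (\<lambda>k. if k < L then f \<circ> cube_to_sphere n k else (\<lambda>u. x0)))"
proof -
  let ?T = "top_of_set {0..1::real}"
  obtain V C where V: "openin X V" "x0 \<in> V"
    and C: "continuous_map (prod_topology ?T (subtopology X V)) X C"
    "\<And>x. x \<in> V \<Longrightarrow> C (0, x) = x" "\<And>x. x \<in> V \<Longrightarrow> C (1, x) = x0"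
    "\<And>s. s \<in> {0..1} \<Longrightarrow> C (s, x0) = x0"
    using semilocal_contraction[OF sc] by metis
  have shrink: "\<exists>K\<ge>1. \<forall>k\<ge>K. \<forall>u. f (cube_to_sphere n k u) \<in> W" if "openin X W" "x0 \<in> W" for W
    using hawaiian_spheres_shrink[OF hawaiian_mapsD(1)[OF f] that(1)] hawaiian_mapsD(2)[OF f] that(2)
      cube_to_sphere_in_hsphere[OF n] by metis
  obtain K where K: "K \<ge> 1" "\<And>k u. k \<ge> K \<Longrightarrow> f (cube_to_sphere n k u) \<in> V"
    using shrink[OF V] by blast
  have fk: "continuous_map (cube n) X (\<lambda>u. f (cube_to_sphere n k u))" if "k \<ge> 1" for k
    using cube_mapsD(1)[OF hawaiian_map_on_sphere[OF f n that]] by (simp add: o_def)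
  have fb: "f (cube_to_sphere n k u) = x0" if "u \<in> cube_boundary n" for k u
    using cube_to_sphere_boundary[OF n that] hawaiian_mapsD(2)[OF f] by simp
  have contr: "continuous_map (prod_topology ?T (cube n)) X (\<lambda>z. C (fst z, f (cube_to_sphere n k (snd z))))"
    if k: "k \<ge> K" for k
  proof -
    have "continuous_map (cube n) (subtopology X V) (\<lambda>u. f (cube_to_sphere n k u))"
      using fk[of k] K k by (auto simp: continuous_map_in_subtopology)
    from continuous_map_compose[OF continuous_map_snd this]
    have "continuous_map (prod_topology ?T (cube n)) (prod_topology ?T (subtopology X V))
            (\<lambda>z. (fst z, f (cube_to_sphere n k (snd z))))"
      by (simp add: continuous_map_pairwise o_def continuous_map_fst)
    from continuous_map_compose[OF this C(1)] show ?thesis by (simp add: o_def)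
  qed
  have tail: "cube_homotopic n X x0 (f \<circ> cube_to_sphere n k) (\<lambda>u. x0)" if k: "k \<ge> K" for k
    unfolding cube_homotopic_iff
    by (rule exI[of _ "\<lambda>z. C (fst z, f (cube_to_sphere n k (snd z)))"])
      (use contr[OF k] K(2)[OF k] C fb in simp)
  have trunc: "hawaiian_homotopic n X x0 f
       (sphere_glue n (\<lambda>k. if k < L then f \<circ> cube_to_sphere n k else (\<lambda>u. x0)))" if L: "L \<ge> K" for L
  proof -
    \<comment> \<open>Stationary on the spheres below \<open>L\<close>; the one contraction
      \<open>C\<close> is applied on all others.\<close>
    define q where "q k z = (if k < L then f (cube_to_sphere n k (snd z))
        else C (fst z, f (cube_to_sphere n k (snd z))))" for k and z :: "real \<times> (nat \<Rightarrow> real)"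
    define H where "H z = sphere_glue n (\<lambda>k u. q k (fst z, u)) (snd z)" for z
    have qb: "q k (s, u) = x0" if "s \<in> {0..1}" "u \<in> cube_boundary n" for k s u
      using fb[OF that(2)] C(4)[OF that(1)] by (simp add: q_def)
    have H: "H (s, cube_to_sphere n k u) = q k (s, u)"
      if "k \<ge> 1" "s \<in> {0..1}" "u \<in> topspace (cube n)" for k s u
      unfolding H_def
      using sphere_glue_cube_to_sphere[OF n that(1,3), of "\<lambda>k u. q k (s, u)" x0] qb that(2) by simp
    have "continuous_map (prod_topology ?T (hawaiian_earring n)) X H"
      unfolding H_def
    proof (rule continuous_map_sphere_glue[OF n])
      show "compact_space ?T" by (simp add: compact_space_subtopology)
      show "Hausdorff_space ?T" by (simp add: Hausdorff_space_subtopology)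
      show "continuous_map (prod_topology ?T (cube n)) X (q k)" if "k \<ge> 1" for k
      proof (cases "k < L")
        case True
        have "continuous_map (prod_topology ?T (cube n)) X (\<lambda>z. f (cube_to_sphere n k (snd z)))"
          using continuous_map_compose[OF continuous_map_snd fk[OF that], of ?T] by (simp add: o_def)
        then show ?thesis using True by (simp add: q_def[abs_def])
      next
        case False
        then show ?thesis using contr[of k] L by (simp add: q_def[abs_def])
      qed
      show "q k (s, u) = x0" if "s \<in> topspace ?T" "u \<in> cube_boundary n" for k s u
        using qb that by simp
      fix W assume W: "openin X W" "x0 \<in> W"
      \<comment> \<open>\<open>C\<close> fixes \<open>x0\<close> at all times, so the open set of
        pairs sent into \<open>W\<close> contains [0,1] x {x0}. Compactness of [0,1] widens this to
        a tube over a neighbourhood \<open>N\<close> of \<open>x0\<close>, which contains almost all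
        spheres of \<open>f\<close>.\<close>
      have pre: "openin (prod_topology ?T (subtopology X V)) {z \<in> topspace (prod_topology ?T (subtopology X V)). C z \<in> W}"
        by (rule openin_continuous_map_preimage[OF C(1) W(1)])
      have cpt: "compactin ?T {0..1}"
        by (simp add: compactin_subtopology)
      have x0V: "x0 \<in> topspace (subtopology X V)" using x0 V by simp
      have sub: "{0..1} \<times> {x0} \<subseteq> {z \<in> topspace (prod_topology ?T (subtopology X V)). C z \<in> W}"
        using C(4) W(2) x0 V by auto
      obtain A N where N: "openin (subtopology X V) N" "{0..1} \<subseteq> A" "x0 \<in> N"
        "A \<times> N \<subseteq> {z \<in> topspace (prod_topology ?T (subtopology X V)). C z \<in> W}"
        using tube_lemma_left[OF pre cpt x0V sub] by blast
      have NV: "N \<subseteq> V" using openin_subset[OF N(1)] by auto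
      have NW: "C (s, x) \<in> W" if "s \<in> {0..1}" "x \<in> N" for s x
      proof -
        have "(s, x) \<in> A \<times> N" using N(2) that by (simp add: subset_iff)
        then show ?thesis using subsetD[OF N(4)] by simp
      qed
      \<comment> \<open>Time 0 of the tube gives that \<open>N\<close> lies in \<open>W\<close>, as
        the spheres on which the homotopy is stationary require.\<close>
      have NW0: "x \<in> W" if "x \<in> N" for x
        using NW[of 0 x] C(2)[OF subsetD[OF NV that]] that by simp
      have "openin X N" using openin_trans_full[OF N(1) V(1)] .
      then obtain M where M: "\<And>k u. k \<ge> M \<Longrightarrow> f (cube_to_sphere n k u) \<in> N"
        using shrink[OF _ N(3)] by blast
      have "q k (s, u) \<in> W" if "k \<ge> M" "s \<in> topspace ?T" for k s u
        using NW[OF _ M[OF that(1)]] NW0[OF M[OF that(1)]] that(2) by (simp add: q_def)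
      then show "\<exists>K. \<forall>k\<ge>K. \<forall>s\<in>topspace ?T. \<forall>u\<in>topspace (cube n). q k (s, u) \<in> W"
        by blast
    qed
    moreover have "H (0, y) = f y" if y: "y \<in> topspace (hawaiian_earring n)" for y
    proof -
      obtain k u where "k \<ge> 1" "u \<in> topspace (cube n)" "y = cube_to_sphere n k u"
        using y mem_hawaiian_earring_cube[OF n] by blast
      then show ?thesis using H[of k 0 u] C(2)[OF K(2), of k u] L by (simp add: q_def)
    qed
    moreover have "H (1, y) = sphere_glue n (\<lambda>k. if k < L then f \<circ> cube_to_sphere n k else (\<lambda>u. x0)) y"
      if y: "y \<in> topspace (hawaiian_earring n)" for y
    proof -
      obtain k u where ku: "k \<ge> 1" "u \<in> topspace (cube n)" "y = cube_to_sphere n k u"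
        using y mem_hawaiian_earring_cube[OF n] by blast
      have "sphere_glue n (\<lambda>k. if k < L then f \<circ> cube_to_sphere n k else (\<lambda>u. x0)) y =
          (if k < L then f \<circ> cube_to_sphere n k else (\<lambda>u. x0)) u"
        unfolding ku(3) by (rule sphere_glue_cube_to_sphere[OF n ku(1,2)]) (auto simp: fb)
      moreover have "H (1, y) = q k (1, u)"
        unfolding ku(3) by (rule H[OF ku(1) _ ku(2)]) simp
      ultimately show ?thesis using C(3)[OF K(2), of k u] L by (simp add: q_def)
    qed
    moreover have "H (s, hawaiian_base) = x0" if "s \<in> {0..1}" for s
      unfolding H_def using sphere_glue_base[OF n, of "\<lambda>k u. q k (s, u)" x0] qb that by simp
    ultimately show ?thesis unfolding hawaiian_homotopic_iff
      by (intro exI[of _ H]) simp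
  qed
  show ?thesis by (rule that[OF tail trunc])
qed

lemma hawaiian_homotopic_imp_spheres:
  assumes "hawaiian_homotopic n X x0 f g" and n: "n \<ge> 1" and k: "k \<ge> 1"
  shows "cube_homotopic n X x0 (f \<circ> cube_to_sphere n k) (g \<circ> cube_to_sphere n k)"
proof -
  let ?T = "top_of_set {0..1::real}"
  obtain h where h: "continuous_map (prod_topology ?T (hawaiian_earring n)) X h"
    "\<And>y. y \<in> topspace (hawaiian_earring n) \<Longrightarrow> h (0, y) = f y"
    "\<And>y. y \<in> topspace (hawaiian_earring n) \<Longrightarrow> h (1, y) = g y"
    "\<And>s. s \<in> {0..1} \<Longrightarrow> h (s, hawaiian_base) = x0"
    using assms(1) unfolding hawaiian_homotopic_iff by blast
  have "continuous_map (prod_topology ?T (cube n)) (prod_topology ?T (hawaiian_earring n))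
          (\<lambda>z. (fst z, cube_to_sphere n k (snd z)))"
    using continuous_map_compose[OF continuous_map_snd continuous_map_cube_to_sphere[OF n k]]
    by (simp add: continuous_map_pairwise o_def continuous_map_fst)
  from continuous_map_compose[OF this h(1)]
  have "continuous_map (prod_topology ?T (cube n)) X (\<lambda>z. h (fst z, cube_to_sphere n k (snd z)))"
    by (simp add: o_def)
  then show ?thesis
    unfolding cube_homotopic_iff
    using h(2-4) cube_to_sphere_in_earring[OF n k] cube_to_sphere_boundary[OF n]
    by (intro exI[of _ "\<lambda>z. h (fst z, cube_to_sphere n k (snd z))"]) simp
qed

text \<open>From index \<open>L\<close> on the glued homotopy is constantly \<open>x0\<close>, so
  the smallness condition is trivial and the homotopies below \<open>L\<close> may be arbitrary and
  unrelated.\<close>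

lemma hawaiian_homotopic_truncated:
  assumes x0: "x0 \<in> topspace X" and n: "n \<ge> 1"
    and fg: "\<And>k. k \<ge> 1 \<Longrightarrow> cube_homotopic n X x0 (p k) (p' k)"
  shows "hawaiian_homotopic n X x0
    (sphere_glue n (\<lambda>k. if k < L then p k else (\<lambda>u. x0)))
    (sphere_glue n (\<lambda>k. if k < L then p' k else (\<lambda>u. x0)))"
proof -
  let ?T = "top_of_set {0..1::real}"
  \<comment> \<open>Bundling the conditions lets a single choice supply a homotopy for each
    sphere.\<close>
  define Q where "Q k h \<longleftrightarrow> continuous_map (prod_topology ?T (cube n)) X h \<and>
          (\<forall>t\<in>topspace (cube n). h (0, t) = p k t) \<and> (\<forall>t\<in>topspace (cube n). h (1, t) = p' k t) \<and>
          (\<forall>s\<in>{0..1}. \<forall>t\<in>cube_boundary n. h (s, t) = x0)" for k h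
  have "\<exists>h. Q k h" if "k \<ge> 1" for k
    using fg[OF that] unfolding cube_homotopic_iff Q_def .
  then obtain h where "\<And>k. k \<ge> 1 \<Longrightarrow> Q k (h k)" by metis
  then have h: "\<And>k. k \<ge> 1 \<Longrightarrow> continuous_map (prod_topology ?T (cube n)) X (h k)"
      "\<And>k t. k \<ge> 1 \<Longrightarrow> t\<in>topspace (cube n) \<Longrightarrow> h k (0, t) = p k t"
      "\<And>k t. k \<ge> 1 \<Longrightarrow> t\<in>topspace (cube n) \<Longrightarrow> h k (1, t) = p' k t"
      "\<And>k s t. k \<ge> 1 \<Longrightarrow> s\<in>{0..1} \<Longrightarrow> t\<in>cube_boundary n \<Longrightarrow> h k (s, t) = x0"
    by (simp_all add: Q_def)
  define q where "q k = (if k < L then h k else (\<lambda>z. x0))" for k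
  define H where "H z = sphere_glue n (\<lambda>k u. q k (fst z, u)) (snd z)" for z
  have qb: "q k (s, u) = x0" if "k \<ge> 1" "s \<in> {0..1}" "u \<in> cube_boundary n" for k s u
    using h(4) that by (simp add: q_def)
  have H: "H (s, cube_to_sphere n k u) = q k (s, u)"
    if "k \<ge> 1" "s \<in> {0..1}" "u \<in> topspace (cube n)" for k s u
    unfolding H_def
    using sphere_glue_cube_to_sphere[OF n that(1,3), of "\<lambda>k u. q k (s, u)" x0] qb that(2) by simp
  have G: "sphere_glue n (\<lambda>k. if k < L then r k else (\<lambda>u. x0)) (cube_to_sphere n k u) =
      (if k < L then r k u else x0)"
    if "k \<ge> 1" "u \<in> topspace (cube n)" "\<And>l. l \<ge> 1 \<Longrightarrow> r l \<in> cube_maps n X x0" for k u r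
    using sphere_glue_cube_to_sphere[OF n that(1,2), of "\<lambda>k. if k < L then r k else (\<lambda>u. x0)" x0]
      cube_mapsD(2)[OF that(3)] by simp
  have "continuous_map (prod_topology ?T (hawaiian_earring n)) X H"
    unfolding H_def
  proof (rule continuous_map_sphere_glue[OF n])
    show "compact_space ?T" by (simp add: compact_space_subtopology)
    show "Hausdorff_space ?T" by (simp add: Hausdorff_space_subtopology)
    show "continuous_map (prod_topology ?T (cube n)) X (q k)" if "k \<ge> 1" for k
      using h(1)[OF that] x0 by (simp add: q_def)
    show "q k (s, u) = x0" if "k \<ge> 1" "s \<in> topspace ?T" "u \<in> cube_boundary n" for k s u
      using qb that by simp
    show "\<exists>K. \<forall>k\<ge>K. \<forall>s\<in>topspace ?T. \<forall>u\<in>topspace (cube n). q k (s, u) \<in> W" if "x0 \<in> W" for W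
      using that by (intro exI[of _ L]) (simp add: q_def)
  qed
  moreover have "H (0, y) = sphere_glue n (\<lambda>k. if k < L then p k else (\<lambda>u. x0)) y \<and>
      H (1, y) = sphere_glue n (\<lambda>k. if k < L then p' k else (\<lambda>u. x0)) y"
    if y: "y \<in> topspace (hawaiian_earring n)" for y
  proof -
    obtain k u where ku: "k \<ge> 1" "u \<in> topspace (cube n)" "y = cube_to_sphere n k u"
      using y mem_hawaiian_earring_cube[OF n] by blast
    have "sphere_glue n (\<lambda>k. if k < L then p k else (\<lambda>u. x0)) y = (if k < L then p k u else x0)"
      "sphere_glue n (\<lambda>k. if k < L then p' k else (\<lambda>u. x0)) y = (if k < L then p' k u else x0)"
      unfolding ku(3) by (intro G ku cube_homotopic_imp_maps[OF fg]; assumption)+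
    moreover have "H (0, y) = q k (0, u)" "H (1, y) = q k (1, u)"
      unfolding ku(3) by (rule H[OF ku(1) _ ku(2)], simp)+
    ultimately show ?thesis
      using h(2,3)[OF ku(1,2)] by (simp add: q_def)
  qed
  moreover have "H (s, hawaiian_base) = x0" if "s \<in> {0..1}" for s
    unfolding H_def using sphere_glue_base[OF n, of "\<lambda>k u. q k (s, u)" x0] qb that by simp
  ultimately show ?thesis unfolding hawaiian_homotopic_iff
    by (intro exI[of _ H]) simp
qed

text \<open>Both maps are cut at the common index \<open>max K M\<close>; the given spherewise
  homotopies are used only below it, and the tails beyond it are joined through the constant
  map.\<close>

lemma spheres_imp_hawaiian_homotopic:
  assumes x0: "x0 \<in> topspace X" and sc: "semilocally_strongly_contractible_at X x0" and n: "n \<ge> 1"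
    and f: "f \<in> hawaiian_maps n X x0" and g: "g \<in> hawaiian_maps n X x0"
    and fg: "\<And>k. k \<ge> 1 \<Longrightarrow> cube_homotopic n X x0 (f \<circ> cube_to_sphere n k) (g \<circ> cube_to_sphere n k)"
  shows "hawaiian_homotopic n X x0 f g"
proof -
  let ?trunc = "\<lambda>L f. sphere_glue n (\<lambda>k. if k < L then f \<circ> cube_to_sphere n k else (\<lambda>u. x0))"
  obtain K where "\<And>k. k \<ge> K \<Longrightarrow> cube_homotopic n X x0 (f \<circ> cube_to_sphere n k) (\<lambda>u. x0)"
    and K: "\<And>L. L \<ge> K \<Longrightarrow> hawaiian_homotopic n X x0 f (?trunc L f)"
    by (rule hawaiian_truncation[OF x0 sc n f]) blast
  obtain M where "\<And>k. k \<ge> M \<Longrightarrow> cube_homotopic n X x0 (g \<circ> cube_to_sphere n k) (\<lambda>u. x0)"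
    and M: "\<And>L. L \<ge> M \<Longrightarrow> hawaiian_homotopic n X x0 g (?trunc L g)"
    by (rule hawaiian_truncation[OF x0 sc n g]) blast
  have fg': "hawaiian_homotopic n X x0 (?trunc (max K M) f) (?trunc (max K M) g)"
    by (rule hawaiian_homotopic_truncated[OF x0 n fg])
  have f': "hawaiian_homotopic n X x0 f (?trunc (max K M) f)" by (rule K) simp
  have "hawaiian_homotopic n X x0 g (?trunc (max K M) g)" by (rule M) simp
  then have "hawaiian_homotopic n X x0 (?trunc (max K M) g) g" by (rule iffD1[OF hawaiian_homotopic_sym])
  with hawaiian_homotopic_trans[OF f' fg'] show ?thesis by (rule hawaiian_homotopic_trans)
qed

section \<open>The isomorphism onto the weak direct product\<close>

theorem theorem2p5:
  fixes X :: "'a topology" and x0 :: 'a and n :: nat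
  assumes "x0 \<in> topspace X"
    and "semilocally_strongly_contractible_at X x0"
    and "n \<ge> 1"
  shows "hawaiian_group n X x0 \<cong> sum_group (UNIV :: nat set) (\<lambda>i. homotopy_group n X x0)"
proof -
  note x0 = assms(1) and sc = assms(2) and n = assms(3)
  let ?G = "hawaiian_group n X x0" and ?P = "homotopy_group n X x0"
  let ?S = "sum_group (UNIV :: nat set) (\<lambda>i. ?P)" and ?M = "hawaiian_maps n X x0"
  \<comment> \<open>The factors are numbered from 0 but the spheres from 1, hence
    \<open>Suc i\<close> here and \<open>k - 1\<close> on the way back.\<close>
  let ?\<sigma> = "\<lambda>i. cube_to_sphere n (Suc i)"
  define \<Phi> where "\<Phi> A = (\<lambda>i::nat. cube_class n X x0 ((SOME f. f \<in> A) \<circ> ?\<sigma> i))" for A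
  have carG: "carrier ?G = hawaiian_class n X x0 ` ?M" by (simp add: hawaiian_group_def)
  \<comment> \<open>\<open>sum_group\<close> is a generated subgroup; the factors being groups
    identifies its carrier with the finitely supported families.\<close>
  have carS: "x \<in> carrier ?S \<longleftrightarrow> (\<forall>i. x i \<in> carrier ?P) \<and> finite {i. x i \<noteq> \<one>\<^bsub>?P\<^esub>}" for x
    by (simp add: carrier_sum_group[OF group_homotopy_group[OF x0 n]] PiE_iff)
  have some: "(SOME g. g \<in> hawaiian_class n X x0 f) \<in> hawaiian_class n X x0 f" if "f \<in> ?M" for f
    by (rule someI[where P = "\<lambda>g. g \<in> hawaiian_class n X x0 f", OF hawaiian_class_self[OF that]])
  \<comment> \<open>Homotopic maps on the earring restrict to homotopic maps on every sphere, so the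
    representative chosen in \<open>\<Phi>\<close> is immaterial.\<close>
  have \<Phi>: "\<Phi> (hawaiian_class n X x0 f) i = cube_class n X x0 (f \<circ> ?\<sigma> i)" if f: "f \<in> ?M" for f i
  proof -
    have "hawaiian_homotopic n X x0 f (SOME g. g \<in> hawaiian_class n X x0 f)"
      using some[OF f] by (simp add: hawaiian_class_def)
    from hawaiian_homotopic_imp_spheres[OF this n, of "Suc i"] show ?thesis
      unfolding \<Phi>_def by (subst eq_commute) (simp add: cube_class_eq_iff cube_homotopic_imp_maps)
  qed
  have in_S: "\<Phi> (hawaiian_class n X x0 f) \<in> carrier ?S" if f: "f \<in> ?M" for f
  proof -
    obtain K where K: "\<And>k. k \<ge> K \<Longrightarrow> cube_homotopic n X x0 (f \<circ> cube_to_sphere n k) (\<lambda>u. x0)"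
      "\<And>L. L \<ge> K \<Longrightarrow> hawaiian_homotopic n X x0 f
         (sphere_glue n (\<lambda>k. if k < L then f \<circ> cube_to_sphere n k else (\<lambda>u. x0)))"
      by (rule hawaiian_truncation[OF x0 sc n f]) blast
    have "\<Phi> (hawaiian_class n X x0 f) i = \<one>\<^bsub>?P\<^esub>" if "i \<ge> K" for i
      using K(1)[of "Suc i"] that cube_homotopic_imp_maps[OF K(1)[of "Suc i"]]
      by (simp add: \<Phi>[OF f] one_homotopy_group cube_class_eq_iff)
    then have "{i. \<Phi> (hawaiian_class n X x0 f) i \<noteq> \<one>\<^bsub>?P\<^esub>} \<subseteq> {..<K}"
      by (auto simp: not_le[symmetric])
    then have "finite {i. \<Phi> (hawaiian_class n X x0 f) i \<noteq> \<one>\<^bsub>?P\<^esub>}"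
      by (rule finite_subset) simp
    moreover have "\<Phi> (hawaiian_class n X x0 f) i \<in> carrier ?P" for i
      unfolding \<Phi>[OF f] carrier_homotopy_group by (intro imageI hawaiian_map_on_sphere f n) simp
    ultimately show ?thesis by (simp add: carS)
  qed
  have "\<Phi> \<in> hom ?G ?S"
  proof (rule homI)
    fix A assume "A \<in> carrier ?G"
    then show "\<Phi> A \<in> carrier ?S" using in_S by (auto simp: carG)
    fix B assume "B \<in> carrier ?G"
    with \<open>A \<in> carrier ?G\<close> obtain f g where f: "f \<in> ?M" "A = hawaiian_class n X x0 f"
      and g: "g \<in> ?M" "B = hawaiian_class n X x0 g" by (auto simp: carG)
    \<comment> \<open>The product in \<open>?G\<close> picks the very representatives that
      \<open>\<Phi>\<close> picks, so multiplicativity can be checked on this pair directly.\<close>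
    let ?f = "SOME f. f \<in> A" and ?g = "SOME g. g \<in> B"
    have f': "?f \<in> ?M" and g': "?g \<in> ?M"
      using some[OF f(1)] some[OF g(1)] by (simp_all add: hawaiian_class_def f(2) g(2))
    have sph: "cube_class n X x0 (hawaiian_concat n ?f ?g \<circ> ?\<sigma> i) =
        cube_class n X x0 (cube_concat (?f \<circ> ?\<sigma> i) (?g \<circ> ?\<sigma> i))" for i
    proof -
      have "cube_homotopic n X x0 (hawaiian_concat n ?f ?g \<circ> ?\<sigma> i) (cube_concat (?f \<circ> ?\<sigma> i) (?g \<circ> ?\<sigma> i))"
        using hawaiian_concat_on_sphere[OF f' g' n, of "Suc i"]
        by (intro cube_homotopic_equal hawaiian_map_on_sphere hawaiian_concat_in_maps f' g' n) auto
      then show ?thesis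
        by (simp add: cube_class_eq_iff cube_homotopic_imp_maps)
    qed
    have "\<Phi> (A \<otimes>\<^bsub>?G\<^esub> B) i = \<Phi> A i \<otimes>\<^bsub>?P\<^esub> \<Phi> B i" for i
    proof -
      have "\<Phi> (A \<otimes>\<^bsub>?G\<^esub> B) i = \<Phi> (hawaiian_class n X x0 (hawaiian_concat n ?f ?g)) i"
        by (simp add: hawaiian_group_def)
      also have "\<dots> = cube_class n X x0 (cube_concat (?f \<circ> ?\<sigma> i) (?g \<circ> ?\<sigma> i))"
        by (simp add: \<Phi>[OF hawaiian_concat_in_maps[OF f' g' n]] sph)
      also have "\<dots> = \<Phi> A i \<otimes>\<^bsub>?P\<^esub> \<Phi> B i"
        unfolding \<Phi>_def by (intro mult_homotopy_group[symmetric] hawaiian_map_on_sphere f' g' n) auto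
      finally show ?thesis .
    qed
    then show "\<Phi> (A \<otimes>\<^bsub>?G\<^esub> B) = \<Phi> A \<otimes>\<^bsub>?S\<^esub> \<Phi> B" by (simp add: fun_eq_iff)
  qed
  moreover have "inj_on \<Phi> (carrier ?G)"
  proof (rule inj_onI)
    fix A B assume A: "A \<in> carrier ?G" and B: "B \<in> carrier ?G" and eq: "\<Phi> A = \<Phi> B"
    obtain f g where f: "f \<in> ?M" "A = hawaiian_class n X x0 f"
      and g: "g \<in> ?M" "B = hawaiian_class n X x0 g" using A B by (auto simp: carG)
    have "cube_homotopic n X x0 (f \<circ> cube_to_sphere n k) (g \<circ> cube_to_sphere n k)" if "k \<ge> 1" for k
    proof -
      have "cube_class n X x0 (f \<circ> cube_to_sphere n k) = cube_class n X x0 (g \<circ> cube_to_sphere n k)"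
        using fun_cong[OF eq, of "k - 1"] that by (simp add: f(2) g(2) \<Phi>[OF f(1)] \<Phi>[OF g(1)])
      then show ?thesis
        by (rule iffD1[OF cube_class_eq_iff[OF hawaiian_map_on_sphere[OF f(1) n that]
              hawaiian_map_on_sphere[OF g(1) n that]]])
    qed
    then show "A = B"
      using spheres_imp_hawaiian_homotopic[OF x0 sc n f(1) g(1)] by (simp add: f(2) g(2) hawaiian_class_eqI)
  qed
  moreover have "\<Phi> ` carrier ?G = carrier ?S"
  proof (intro equalityI subsetI)
    show "x \<in> carrier ?S" if "x \<in> \<Phi> ` carrier ?G" for x
      using that in_S by (auto simp: carG)
    fix x assume x: "x \<in> carrier ?S"
    \<comment> \<open>For a trivial factor the representative must be literally constant: an
      infinite family of merely null-homotopic maps need not shrink to \<open>x0\<close>, and the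
      glued map could fail to be continuous.\<close>
    have "\<exists>p. p \<in> cube_maps n X x0 \<and> x i = cube_class n X x0 p \<and> (x i = \<one>\<^bsub>?P\<^esub> \<longrightarrow> p = (\<lambda>u. x0))" for i
    proof (cases "x i = \<one>\<^bsub>?P\<^esub>")
      case True
      then show ?thesis using cube_maps_const[OF x0] one_homotopy_group[of n X x0] by blast
    next
      case False
      have "x i \<in> cube_class n X x0 ` cube_maps n X x0"
        using x by (simp add: carS carrier_homotopy_group)
      then show ?thesis using False by blast
    qed
    then obtain p where p: "\<And>i. p i \<in> cube_maps n X x0" "\<And>i. x i = cube_class n X x0 (p i)"
      "\<And>i. x i = \<one>\<^bsub>?P\<^esub> \<Longrightarrow> p i = (\<lambda>u. x0)" by metis
    have "finite {i. x i \<noteq> \<one>\<^bsub>?P\<^esub>}" using x by (simp add: carS)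
    then obtain K where K: "\<And>i. x i \<noteq> \<one>\<^bsub>?P\<^esub> \<Longrightarrow> i < K"
      using finite_nat_set_iff_bounded by auto
    \<comment> \<open>The index shift turns the bound \<open>K\<close> on the support into
      \<open>Suc K\<close> for spheres.\<close>
    have const: "p (k - 1) u = x0" if "k \<ge> Suc K" for k u
      using K[of "k - 1"] p(3)[of "k - 1"] that by fastforce
    define f where "f = sphere_glue n (\<lambda>k. p (k - 1))"
    have f: "f \<in> ?M"
      unfolding f_def
    proof (rule sphere_glue_in_hawaiian_maps[OF n])
      show "p (k - 1) \<in> cube_maps n X x0" for k by (rule p(1))
      show "\<exists>K. \<forall>k\<ge>K. \<forall>u\<in>topspace (cube n). p (k - 1) u \<in> W" if "x0 \<in> W" for W
        using const that by (intro exI[of _ "Suc K"]) auto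
    qed
    have "\<Phi> (hawaiian_class n X x0 f) i = x i" for i
    proof -
      have "f (?\<sigma> i t) = p i t" if "t \<in> topspace (cube n)" for t
        using sphere_glue_cube_to_sphere[OF n _ that, of "Suc i" "\<lambda>k. p (k - 1)" x0] cube_mapsD(2)[OF p(1)]
        by (simp add: f_def)
      then have "cube_homotopic n X x0 (p i) (f \<circ> ?\<sigma> i)"
        by (intro cube_homotopic_equal p(1)) simp
      then show ?thesis
        unfolding \<Phi>[OF f] p(2) by (subst eq_commute) (simp add: cube_class_eq_iff cube_homotopic_imp_maps)
    qed
    then have "\<Phi> (hawaiian_class n X x0 f) = x" by (simp add: fun_eq_iff)
    then show "x \<in> \<Phi> ` carrier ?G" using f carG by blast
  qed
  ultimately have "\<Phi> \<in> iso ?G ?S" by (simp add: iso_def bij_betw_def)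
  then show ?thesis by (auto simp: is_iso_def)
qed

end
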